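(* Let $m$ be a square-free positive integer with $m\equiv 2 \pmod 4$ or $m\equiv 3 \pmod 4$. Then the number field $K=\mathbb{Q}(i,\sqrt[4]{m})$ is not monogene; that is, there is no $\alpha\in\mathbb{Z}_K$ with $\mathbb{Z}_K=\mathbb{Z}[\alpha]$.
   Context: Here $i$ is the imaginary unit ($i^2=-1$) and $\sqrt[4]{m}$ is the positive real fourth root of $m$. For a number field $K$ of degree $n$ over $\mathbb{Q}$, $\mathbb{Z}_K$ denotes its ring of integers. The field $K$ is called monogene if there is an $\alpha\in\mathbb{Z}_K$ such that $\mathbb{Z}_K=\mathbb{Z}[\alpha]$, equivalently such that $\{1,\alpha,\ldots,\alpha^{n-1}\}$ is an integral basis of $K$ (a $\mathbb{Z}$-basis of $\mathbb{Z}_K$), called a power integral basis. *)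

theory Defs
  imports
    Complex_Main
    "HOL-Computational_Algebra.Computational_Algebra"
    "HOL-Number_Theory.Cong"
    "HOL-Algebra.Generated_Fields"
    "HOL-Algebra.Algebraic_Closure_Type"
begin

text \<open>
  Number fields are rendered as subfields of the complex numbers, the field of complex numbers
  being viewed as a HOL-Algebra structure through \<^term>\<open>ring_of_type_algebra\<close>.
\<close>

abbreviation complex_field :: "complex ring" where
  "complex_field \<equiv> ring_of_type_algebra"

definition rat_adjoin :: "complex set \<Rightarrow> complex set" where
  "rat_adjoin S = generate_field complex_field (\<rat> \<union> S)"

definition int_adjoin :: "complex \<Rightarrow> complex set" where
  "int_adjoin \<alpha> = generate_ring complex_field (\<int> \<union> {\<alpha>})"

definition ring_of_integers :: "complex set \<Rightarrow> complex set" where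
  "ring_of_integers K = {x \<in> K. algebraic_int x}"

definition monogene :: "complex set \<Rightarrow> bool" where
  "monogene K \<longleftrightarrow> (\<exists>\<alpha>\<in>ring_of_integers K. ring_of_integers K = int_adjoin \<alpha>)"

lemma subfield_rat_adjoin: "subfield (rat_adjoin S) complex_field"
proof -
  interpret C: field complex_field by (rule field_from_type_algebra)
  show ?thesis unfolding rat_adjoin_def
    by (rule C.generate_field_is_subfield) (simp add: ring_of_type_algebra_def)
qed

lemma a_inv_complex_field: "\<ominus>\<^bsub>complex_field\<^esub> x = - x"
proof -
  interpret C: field complex_field by (rule field_from_type_algebra)
  have "\<ominus>\<^bsub>complex_field\<^esub> x \<oplus>\<^bsub>complex_field\<^esub> x = \<zero>\<^bsub>complex_field\<^esub>"
    by (rule C.l_neg) (simp add: ring_of_type_algebra_def)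
  thus ?thesis by (simp add: ring_of_type_algebra_def add_eq_0_iff2)
qed

lemma map_poly_of_int_complex:
  fixes p q :: "int poly"
  shows "map_poly of_int (- p) = - (map_poly of_int p :: complex poly)"
    and "map_poly of_int (p + q) = (map_poly of_int p + map_poly of_int q :: complex poly)"
    and "map_poly of_int (p * q) = (map_poly of_int p * map_poly of_int q :: complex poly)"
  by (intro poly_eqI; simp add: coeff_map_poly coeff_mult)+

lemma int_adjoin_eq_poly: "int_adjoin \<alpha> = range (\<lambda>p :: int poly. poly (map_poly of_int p) \<alpha>)"
proof (intro equalityI subsetI)
  fix x assume "x \<in> int_adjoin \<alpha>"
  then have "x \<in> generate_ring complex_field (\<int> \<union> {\<alpha>})" by (simp add: int_adjoin_def)
  then show "x \<in> range (\<lambda>p :: int poly. poly (map_poly of_int p) \<alpha>)"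
  proof induction
    case one
    show ?case by (rule range_eqI[of _ _ 1]) (simp add: ring_of_type_algebra_def)
  next
    case (incl h)
    then consider n where "h = of_int n" | "h = \<alpha>" by (auto elim: Ints_cases)
    then show ?case
    proof cases
      case (1 n)
      then show ?thesis by (intro range_eqI[of _ _ "[:n:]"]) (simp add: map_poly_pCons)
    next
      case 2
      then show ?thesis by (intro range_eqI[of _ _ "[:0, 1:]"]) (simp add: map_poly_pCons)
    qed
  next
    case (a_inv h)
    then obtain p where "h = poly (map_poly of_int (p :: int poly)) \<alpha>" by auto
    then show ?case
      by (intro range_eqI[of _ _ "- p"]) (simp add: a_inv_complex_field map_poly_of_int_complex)
  next
    case (eng_add h1 h2)
    then obtain p q where "h1 = poly (map_poly of_int (p :: int poly)) \<alpha>"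
      "h2 = poly (map_poly of_int (q :: int poly)) \<alpha>" by auto
    then show ?case
      by (intro range_eqI[of _ _ "p + q"]) (simp add: ring_of_type_algebra_def map_poly_of_int_complex)
  next
    case (eng_mult h1 h2)
    then obtain p q where "h1 = poly (map_poly of_int (p :: int poly)) \<alpha>"
      "h2 = poly (map_poly of_int (q :: int poly)) \<alpha>" by auto
    then show ?case
      by (intro range_eqI[of _ _ "p * q"]) (simp add: ring_of_type_algebra_def map_poly_of_int_complex)
  qed
next
  fix x assume "x \<in> range (\<lambda>p :: int poly. poly (map_poly of_int p) \<alpha>)"
  then obtain p :: "int poly" where "x = poly (map_poly of_int p) \<alpha>" by auto
  moreover have "poly (map_poly of_int p) \<alpha> \<in> int_adjoin \<alpha>"
  proof (induction p)
    case 0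
    have "0 \<in> int_adjoin \<alpha>" unfolding int_adjoin_def by (rule generate_ring.incl) simp
    then show ?case by simp
  next
    case (pCons a p)
    have "\<alpha> \<in> int_adjoin \<alpha>" "of_int a \<in> int_adjoin \<alpha>"
      unfolding int_adjoin_def by (rule generate_ring.incl; simp)+
    with pCons.IH show ?case
      using generate_ring.eng_add[of _ complex_field] generate_ring.eng_mult[of _ complex_field]
      unfolding int_adjoin_def
      by (simp add: map_poly_pCons ring_of_type_algebra_def)
  qed
  ultimately show "x \<in> int_adjoin \<alpha>" by simp
qed

end

theory Submission
  imports Defs
begin

text \<open>
  Write \<open>\<theta>\<close> for the positive fourth root of \<open>m\<close> and suppose that \<open>\<alpha>\<close> generates the ring of integers.
  For an automorphism \<open>\<sigma>\<close> of \<open>K\<close> every difference \<open>x - \<sigma> x\<close> of an integer \<open>x\<close> is then a multiple of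
  \<open>\<alpha> - \<sigma> \<alpha>\<close>. For the two automorphisms sending \<open>\<i>\<close> to \<open>- \<i>\<close> and \<open>\<theta>\<close> to \<open>- \<i> \<theta>\<close> or \<open>\<i> \<theta>\<close>, take
  \<open>x = \<i>\<close>, \<open>x = \<theta>\<close> and, for even \<open>m\<close>, \<open>x = \<theta> (1 + \<eta>) / (1 + \<i>)\<close> with \<open>\<eta> = \<theta>\<^sup>2 / (1 + \<i>)\<close>.
  The norms \<open>N\<close>, \<open>N'\<close> of \<open>\<alpha> - \<sigma> \<alpha>\<close> over \<open>\<rat>(\<i>)\<close> must divide \<open>4\<close> if \<open>m\<close> is odd and \<open>2\<close> if \<open>m\<close> is even.
  They are of the shape \<open>A\<^sup>2 + m B\<^sup>2\<close>, with \<open>A\<close> and \<open>B\<close> quadratic forms in the coordinates of \<open>\<alpha>\<close>.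
  This bounds \<open>A\<close> and \<open>B\<close> so tightly that the two conditions together contradict the parity
  conditions which an integral basis imposes on the coordinates of \<open>\<alpha>\<close>.
\<close>

section \<open>Gaussian numbers and cubic expressions\<close>

definition gauss_rat :: "complex set" where
  "gauss_rat = {z. Re z \<in> \<rat> \<and> Im z \<in> \<rat>}"

definition gauss_int :: "complex set" where
  "gauss_int = {z. Re z \<in> \<int> \<and> Im z \<in> \<int>}"

lemma gauss_rat_arith [simp, intro]:
  assumes "x \<in> gauss_rat" "y \<in> gauss_rat"
  shows "x + y \<in> gauss_rat" "x - y \<in> gauss_rat" "x * y \<in> gauss_rat"
  using assms by (auto simp: gauss_rat_def)

lemma gauss_rat_unary [simp, intro]:
  assumes "x \<in> gauss_rat"
  shows "- x \<in> gauss_rat" "cnj x \<in> gauss_rat" "inverse x \<in> gauss_rat" "x ^ n \<in> gauss_rat"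
proof -
  show "x ^ n \<in> gauss_rat"
    by (induction n) (use assms in \<open>auto simp: gauss_rat_def\<close>)
qed (use assms in \<open>auto simp: gauss_rat_def\<close>)

lemma gauss_rat_divide [simp, intro]:
  "x \<in> gauss_rat \<Longrightarrow> y \<in> gauss_rat \<Longrightarrow> x / y \<in> gauss_rat"
  by (simp add: divide_inverse)

lemma gauss_rat_const [simp, intro]:
  "0 \<in> gauss_rat" "1 \<in> gauss_rat" "\<i> \<in> gauss_rat" "of_nat k \<in> gauss_rat" "of_int l \<in> gauss_rat"
  "numeral w \<in> gauss_rat"
  by (auto simp: gauss_rat_def)

lemma gauss_int_arith [simp, intro]:
  assumes "x \<in> gauss_int" "y \<in> gauss_int"
  shows "x + y \<in> gauss_int" "x - y \<in> gauss_int" "x * y \<in> gauss_int"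
  using assms by (auto simp: gauss_int_def)

lemma gauss_int_unary [simp, intro]:
  assumes "x \<in> gauss_int"
  shows "- x \<in> gauss_int" "cnj x \<in> gauss_int" "x ^ n \<in> gauss_int"
proof -
  show "x ^ n \<in> gauss_int"
    by (induction n) (use assms in \<open>auto simp: gauss_int_def\<close>)
qed (use assms in \<open>auto simp: gauss_int_def\<close>)

lemma gauss_int_const [simp, intro]:
  "0 \<in> gauss_int" "1 \<in> gauss_int" "\<i> \<in> gauss_int" "of_nat k \<in> gauss_int" "of_int l \<in> gauss_int"
  "numeral w \<in> gauss_int"
  by (auto simp: gauss_int_def)

lemma gauss_int_iff: "z \<in> gauss_int \<longleftrightarrow> (\<exists>x y :: int. z = of_int x + \<i> * of_int y)"
proof
  assume "z \<in> gauss_int"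
  then obtain x y where "Re z = of_int x" "Im z = of_int y" by (auto simp: gauss_int_def elim!: Ints_cases)
  then have "z = of_int x + \<i> * of_int y" by (simp add: complex_eq_iff)
  then show "\<exists>x y :: int. z = of_int x + \<i> * of_int y" by blast
qed (auto simp: gauss_int_def)

lemma of_int_div_in_Ints_iff:
  assumes "k \<noteq> 0"
  shows "(of_int n / of_int k :: 'a :: field_char_0) \<in> \<int> \<longleftrightarrow> k dvd n"
proof
  assume "(of_int n / of_int k :: 'a) \<in> \<int>"
  then obtain l where "(of_int n / of_int k :: 'a) = of_int l" by (auto elim: Ints_cases)
  with assms have "(of_int n :: 'a) = of_int (k * l)" by (simp add: field_simps)
  then show "k dvd n" by (simp only: of_int_eq_iff) simp
next
  assume "k dvd n"
  then obtain l where "n = k * l" ..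
  with assms show "(of_int n / of_int k :: 'a) \<in> \<int>" by simp
qed

lemma dvd_parts_if_gauss_int:
  assumes "(of_int x + \<i> * of_int y) / of_int k \<in> gauss_int" "k \<noteq> 0"
  shows "k dvd x" "k dvd y"
proof -
  have "(of_int x + \<i> * of_int y) / of_int k = Complex (of_int x / of_int k) (of_int y / of_int k)"
    using assms(2) by (simp add: complex_eq_iff)
  with assms show "k dvd x" "k dvd y"
    by (auto simp: gauss_int_def of_int_div_in_Ints_iff)
qed

definition cubic :: "'a :: comm_ring_1 \<Rightarrow> 'a \<Rightarrow> 'a \<Rightarrow> 'a \<Rightarrow> 'a \<Rightarrow> 'a" where
  "cubic a b c d z = a + b * z + c * z ^ 2 + d * z ^ 3"

text \<open>
  If \<open>z\<^sup>4 = n\<close>, then \<open>norm_fst n a b c d + z\<^sup>2 norm_snd n a b c d\<close> is the norm of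
  \<open>cubic a b c d z\<close> down to the subfield generated by \<open>z\<^sup>2\<close>.
\<close>

definition norm_fst :: "'a :: comm_ring_1 \<Rightarrow> 'a \<Rightarrow> 'a \<Rightarrow> 'a \<Rightarrow> 'a \<Rightarrow> 'a" where
  "norm_fst n a b c d = a ^ 2 + n * c ^ 2 - 2 * n * b * d"

definition norm_snd :: "'a :: comm_ring_1 \<Rightarrow> 'a \<Rightarrow> 'a \<Rightarrow> 'a \<Rightarrow> 'a \<Rightarrow> 'a" where
  "norm_snd n a b c d = 2 * a * c - b ^ 2 - n * d ^ 2"

lemma cubic_times_cubic_minus:
  assumes "z ^ 4 = n"
  shows "cubic a b c d z * cubic a b c d (- z) = norm_fst n a b c d + z ^ 2 * norm_snd n a b c d"
  unfolding cubic_def norm_fst_def norm_snd_def assms[symmetric]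
  by (simp add: power2_eq_square power3_eq_cube power4_eq_xxxx algebra_simps)

text \<open>Besides \<open>z\<close>, also \<open>\<i> * z\<close> is a fourth root of
  \<open>n\<close>, with square \<open>- (z ^ 2)\<close>. So the second pair of factors is the first
  with the sign of the \<open>norm_snd\<close> term reversed: a norm taken in two quadratic
  stages.\<close>

lemma cubic_norm:
  fixes z :: complex
  assumes "z ^ 4 = n"
  shows "cubic a b c d z * cubic a b c d (- z) * (cubic a b c d (\<i> * z) * cubic a b c d (- (\<i> * z)))
    = norm_fst n a b c d ^ 2 - n * norm_snd n a b c d ^ 2"
proof -
  have "(\<i> * z) ^ 4 = n" using assms by (simp add: power_mult_distrib)
  then have "cubic a b c d (\<i> * z) * cubic a b c d (- (\<i> * z)) =
     norm_fst n a b c d - z ^ 2 * norm_snd n a b c d"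
    by (simp add: cubic_times_cubic_minus power_mult_distrib)
  with assms show ?thesis
    by (simp only: cubic_times_cubic_minus) (simp add: assms[symmetric] power2_eq_square power4_eq_xxxx algebra_simps)
qed

section \<open>Integrality criteria for a square-free radicand\<close>

lemma rat_times_square_Int:
  fixes r :: "'a :: field_char_0"
  assumes "r \<in> \<rat>" "of_nat m * r ^ 2 \<in> \<int>" "squarefree m"
  shows "r \<in> \<int>"
proof -
  from assms(1) obtain a b :: int where ab: "r = of_int a / of_int b" "b > 0" "coprime a b"
    by (metis Rats_cases')
  from assms(2) obtain k where k: "of_nat m * r ^ 2 = of_int k" by (auto elim: Ints_cases)
  have "(of_int (int m * a ^ 2) :: 'a) = of_int (k * b ^ 2)"
    using k ab by (simp add: field_simps power2_eq_square)
  then have "int m * a ^ 2 = k * b ^ 2" by (simp only: of_int_eq_iff)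
  \<comment> \<open>In lowest terms \<open>b ^ 2\<close> is coprime to \<open>a ^ 2\<close>, so it
    divides \<open>m\<close>, and square-freeness leaves only \<open>b = 1\<close>.\<close>
  then have "b ^ 2 dvd int m * a ^ 2" by simp
  moreover have "coprime (b ^ 2) (a ^ 2)" using ab by (simp add: coprime_commute)
  ultimately have "b ^ 2 dvd int m" using coprime_dvd_mult_left_iff by blast
  moreover have "b = int (nat b)" using ab by simp
  ultimately have "(nat b) ^ 2 dvd m" by (metis of_nat_dvd_iff of_nat_power)
  with assms(3) have "nat b dvd 1" by (rule squarefreeD)
  with ab have "b = 1" by auto
  with ab show ?thesis by simp
qed

text \<open>The integers of Q(sqrt m) are Z[sqrt m] for such \<open>m\<close>; the hypotheses speak
  of trace and norm of A + B sqrt m. Square-freeness makes \<open>2 * B\<close> integral, then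
  squares modulo 4 exclude halves.\<close>

lemma squarefree_half_integral:
  fixes A B :: "'a :: field_char_0"
  assumes "2 * A \<in> \<int>" "B \<in> \<rat>" "A ^ 2 - of_nat m * B ^ 2 \<in> \<int>"
    and "squarefree m" "[m = 2] (mod 4) \<or> [m = 3] (mod 4)"
  shows "A \<in> \<int> \<and> B \<in> \<int>"
proof -
  from assms(1) obtain a where a: "2 * A = of_int a" by (auto elim: Ints_cases)
  from assms(3) obtain k where k: "A ^ 2 - of_nat m * B ^ 2 = of_int k" by (auto elim: Ints_cases)
  have "of_nat m * (2 * B) ^ 2 = (2 * A) ^ 2 - 4 * of_int k"
    by (simp add: k[symmetric] power2_eq_square algebra_simps)
  also have "\<dots> \<in> \<int>" by (simp add: a)
  finally have "2 * B \<in> \<int>" 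
    by (rule rat_times_square_Int[rotated]) (use assms in simp_all)
  then obtain b where b: "2 * B = of_int b" by (auto elim: Ints_cases)
  have "of_int (a ^ 2 - int m * b ^ 2) = (of_int (4 * k) :: 'a)"
    by (simp add: a[symmetric] b[symmetric] k[symmetric] power2_eq_square algebra_simps)
  then have eq: "a ^ 2 - int m * b ^ 2 = 4 * k" by (simp only: of_int_eq_iff)
  from assms(5) obtain l :: int where l: "int m = 4 * l + 2 \<or> int m = 4 * l + 3"
  proof -
    from assms(5) have "m mod 4 = 2 \<or> m mod 4 = 3" by (auto simp: cong_def)
    then have "int m = 4 * int (m div 4) + 2 \<or> int m = 4 * int (m div 4) + 3"
      by presburger
    then show ?thesis using that by blast
  qed
  have sq: "\<exists>j. x ^ 2 = 4 * j" if "even x" for x :: int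
    using that by (auto simp: power2_eq_square elim!: evenE)
  have sq': "\<exists>j. x ^ 2 = 4 * j + 1" if "odd x" for x :: int
  proof -
    from that obtain y where "x = 2 * y + 1" by (elim oddE)
    then have "x ^ 2 = 4 * (y ^ 2 + y) + 1" by (simp add: power2_eq_square algebra_simps)
    then show ?thesis ..
  qed
  have "even a \<and> even b"
  proof (cases "even b")
    case True
    then have "even (a ^ 2)" using arg_cong[OF eq, of even] by simp
    then show ?thesis using True by simp
  next
    case False
    then obtain j where j: "b ^ 2 = 4 * j + 1" using sq' by blast
    obtain i where i: "a ^ 2 = 4 * i \<or> a ^ 2 = 4 * i + 1" using sq sq' by (cases "even a") blast+
    \<comment> \<open>For odd \<open>b\<close> the square \<open>a ^ 2\<close> is congruent to
      \<open>m\<close> modulo 4, but neither 2 nor 3 is a square there.\<close>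
    have "int m + 4 * (int m * j + k) = a ^ 2" using eq unfolding j by (simp add: algebra_simps)
    then have "int m mod 4 = a ^ 2 mod 4" by (metis mod_mult_self2)
    then show ?thesis using l i by (auto simp: mod_simps)
  qed
  then obtain a' b' where "a = 2 * a'" "b = 2 * b'" by (auto elim!: evenE)
  with a b have "A = of_int a'" "B = of_int b'" by auto
  then show ?thesis by simp
qed

section \<open>Arithmetic of the coordinates\<close>

text \<open>One step of clearing denominators: an element with coefficients \<open>a / p\<close>,
  ..., \<open>d / p\<close> has integral norm parts. If \<open>p\<close> divides \<open>m\<close>,
  it does so exactly once, and \<open>a\<close>, \<open>b\<close>, \<open>c\<close>,
  \<open>d\<close> are peeled off in this order, alternating between the two norm parts. The other
  case is \<open>p = 2\<close> with odd \<open>m\<close>.\<close>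

lemma prime_dvd_coeffs_if_square_dvd_norms:
  fixes a b c d :: int
  assumes "Factorial_Ring.prime p" "p dvd 2 * m" "squarefree m" "[m = 2] (mod 4) \<or> [m = 3] (mod 4)"
    and fst: "int p ^ 2 dvd norm_fst (int m) a b c d"
    and snd: "int p ^ 2 dvd norm_snd (int m) a b c d"
  shows "int p dvd a \<and> int p dvd b \<and> int p dvd c \<and> int p dvd d"
proof (cases "p dvd m")
  case True
  then obtain n where n: "m = p * n" ..
  have p: "Factorial_Ring.prime (int p)" and p0: "int p \<noteq> 0" using assms(1) by auto
  have "\<not> p ^ 2 dvd m" using assms(1,3) by (metis not_prime_unit squarefreeD)
  then have "\<not> int p dvd int n" using n by (auto simp: power2_eq_square)
  have cancel: "int p dvd int n * e \<longleftrightarrow> int p dvd e" for e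
    using p \<open>\<not> int p dvd int n\<close> by (auto simp: prime_dvd_mult_iff)
  have pdiv: "int p dvd x" if "int p ^ 2 dvd x" for x
    using that by (metis dvd_mult_left power2_eq_square)
  have "int p dvd norm_fst (int m) a b c d + int p * (int n * (2 * b * d - c ^ 2))"
    using pdiv[OF fst] by simp
  then have "int p dvd a ^ 2" by (simp add: norm_fst_def n algebra_simps)
  then have "int p dvd a" using p prime_dvd_power by blast
  then obtain a' where a: "a = int p * a'" ..
  \<comment> \<open>With \<open>a ^ 2\<close> divisible by \<open>p ^ 2\<close>, the first condition
    can be read modulo \<open>p ^ 2\<close> and informs about the terms that carry
    \<open>m\<close>.\<close>
  have "int p ^ 2 dvd norm_fst (int m) a b c d - int p ^ 2 * a' ^ 2"
    using fst by simp
  also have "\<dots> = int p * (int n * (c ^ 2 - 2 * b * d))"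
    by (simp add: norm_fst_def n a algebra_simps power_mult_distrib)
  finally have cbd: "int p dvd c ^ 2 - 2 * b * d"
    using p0 by (simp add: power2_eq_square cancel)
  have "int p dvd int p * (2 * a' * c - int n * d ^ 2) - norm_snd (int m) a b c d"
    using pdiv[OF snd] by simp
  then have "int p dvd b ^ 2" by (simp add: norm_snd_def n a algebra_simps)
  then have "int p dvd b" using p prime_dvd_power by blast
  then obtain b' where b: "b = int p * b'" ..
  have "int p dvd (c ^ 2 - 2 * b * d) + int p * (2 * b' * d)" using cbd by simp
  then have "int p dvd c ^ 2" by (simp add: b)
  then have "int p dvd c" using p prime_dvd_power by blast
  then obtain c' where c: "c = int p * c'" ..
  have "int p ^ 2 dvd int p ^ 2 * (2 * a' * c' - b' ^ 2) - norm_snd (int m) a b c d"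
    using snd by simp
  also have "\<dots> = int p * (int n * d ^ 2)"
    by (simp add: norm_snd_def n a b c algebra_simps power2_eq_square)
  finally have "int p dvd d ^ 2" using p0 by (simp add: power2_eq_square cancel)
  then have "int p dvd d" using p prime_dvd_power by blast
  with \<open>int p dvd a\<close> \<open>int p dvd b\<close> \<open>int p dvd c\<close> show ?thesis by blast
next
  case False
  then have "p dvd 2" using assms(1,2) by (auto simp: prime_dvd_mult_iff)
  with assms(1) have p: "p = 2" using primes_dvd_imp_eq two_is_prime_nat by blast
  with False assms(4) have "m mod 4 = 3" by (auto simp: cong_def) presburger
  then have m: "int m = 4 * int (m div 4) + 3" by presburger
  define l where "l = int (m div 4)"
  note m = m[folded l_def]
  have "even (norm_fst (int m) a b c d)" "even (norm_snd (int m) a b c d)"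
    using fst snd by (auto simp: p power2_eq_square dest: dvd_mult_left)
  then have "even (a - c)" "even (b - d)" by (auto simp: norm_fst_def norm_snd_def m)
  then obtain u v where "a - c = 2 * u" "b - d = 2 * v" by (elim evenE)
  then have cd: "c = a - 2 * u" "d = b - 2 * v" by simp_all
  \<comment> \<open>Since \<open>m + 1 = 4 * (l + 1)\<close>, everything except
    \<open>2 * b ^ 2\<close> and \<open>2 * a ^ 2\<close> is a multiple of 4.\<close>
  have "norm_fst (int m) a b c d = 4 * (a ^ 2 * (l + 1) + int m * (u ^ 2 - a * u + b * v) - 2 * (l + 1) * b ^ 2) + 2 * b ^ 2"
    "norm_snd (int m) a b c d = 4 * (- a * u - b ^ 2 * (l + 1) + int m * (b * v - v ^ 2)) + 2 * a ^ 2"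
    unfolding norm_fst_def norm_snd_def m cd by (simp_all add: algebra_simps power2_eq_square)
  with fst snd have "4 dvd 2 * b ^ 2" "4 dvd 2 * a ^ 2" by (simp_all add: p dvd_add_right_iff)
  then have "even b" "even a"
    using dvd_times_left_cancel_iff[of "2 :: int" 2 "b ^ 2"] dvd_times_left_cancel_iff[of "2 :: int" 2 "a ^ 2"] by auto
  with p cd show ?thesis by auto
qed

section \<open>The norm equations for a generator\<close>

lemma even_twist_norm_dvd_two:
  fixes y0 x2 s q :: int
  assumes "N dvd 2" "N \<noteq> 0" "even y0" "even s" "m > 0" "m = 2 * n"
    and "4 * N = 4 * (y0\<^sup>2 - m * x2\<^sup>2 + m * s * q)\<^sup>2 + m * (4 * y0 * x2 - s\<^sup>2 + m * q\<^sup>2)\<^sup>2"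
  shows "y0\<^sup>2 - m * x2\<^sup>2 + m * s * q = 0" "odd q"
proof -
  from assms obtain t where t: "s = 2 * t" by (elim evenE)
  define A where "A = y0\<^sup>2 - m * x2\<^sup>2 + m * s * q"
  define B where "B = 2 * y0 * x2 - 2 * t\<^sup>2 + n * q\<^sup>2"
  have "even A" using assms by (simp add: A_def)
  then obtain A' where A': "A = 2 * A'" ..
  have "4 * N = 4 * A\<^sup>2 + m * (2 * B)\<^sup>2"
    by (simp only: A_def B_def assms(7)) (simp add: t assms(6) power2_eq_square algebra_simps)
  \<comment> \<open>have N: the right-hand side is even and nonnegative, so the nonzero divisor
    \<open>N\<close> of 2 equals 2. What remains, \<open>2 * A'\<^sup>2 + n * B\<^sup>2 = 1\<close>,
    leaves no room for \<open>A'\<close>.\<close>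
  then have N: "N = 2 * (2 * A'\<^sup>2 + n * B\<^sup>2)" using assms(6) A' by (simp add: power2_eq_square)
  have n: "n > 0" using assms by simp
  have "N \<ge> 0" using n unfolding N by simp
  moreover have "\<bar>N\<bar> \<le> 2" using dvd_imp_le_int[OF _ assms(1)] by simp
  moreover have "even N" using N by simp
  ultimately have "N = 2" using assms(2) by presburger
  with N have 1: "2 * A'\<^sup>2 + n * B\<^sup>2 = 1" by simp
  moreover have "n * B\<^sup>2 \<ge> 0" using n by simp
  moreover have "A'\<^sup>2 \<ge> 0" by simp
  ultimately have "A'\<^sup>2 = 0" by linarith
  then have A0: "A' = 0" by simp
  with 1 have "n * B\<^sup>2 = 1" by simp
  then have "odd (n * B\<^sup>2)" by simp
  then have "odd B" "odd n" by auto
  then show "odd q" by (auto simp: B_def)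
  show "y0\<^sup>2 - m * x2\<^sup>2 + m * s * q = 0" using A0 A' A_def by simp
qed

text \<open>Both first forms vanish, and their difference yields \<open>y1 * x3 = x1 * y3\<close>.
  By parity \<open>x1\<close> and \<open>y1\<close> are odd while exactly one of \<open>x3\<close>
  and \<open>y3\<close> is, so the equality fails modulo 2.\<close>

lemma even_no_solution:
  fixes y0 x1 y1 x2 x3 y3 m N N' :: int
  assumes "m > 0" "even m" "N dvd 2" "N \<noteq> 0" "N' dvd 2" "N' \<noteq> 0"
    and par: "even y0" "even (x1 - x3 + y3)" "even (y1 - x3 - y3)"
    and N: "4 * N = 4 * (y0\<^sup>2 - m * x2\<^sup>2 + m * (x1 + y1) * (x3 - y3))\<^sup>2
       + m * (4 * y0 * x2 - (x1 + y1)\<^sup>2 + m * (x3 - y3)\<^sup>2)\<^sup>2"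
    and N': "4 * N' = 4 * (y0\<^sup>2 - m * (- x2)\<^sup>2 + m * (x1 - y1) * (x3 + y3))\<^sup>2
       + m * (4 * y0 * (- x2) - (x1 - y1)\<^sup>2 + m * (x3 + y3)\<^sup>2)\<^sup>2"
  shows False
proof -
  from assms(2) obtain n where n: "m = 2 * n" ..
  have "even (x1 + y1)" "even (x1 - y1)" using par(2,3) by presburger+
  note E = even_twist_norm_dvd_two[OF assms(3,4) par(1) this(1) assms(1) n N]
    and E' = even_twist_norm_dvd_two[OF assms(5,6) par(1) this(2) assms(1) n N']
  have "2 * m * (y1 * x3 - x1 * y3) = (y0\<^sup>2 - m * x2\<^sup>2 + m * (x1 + y1) * (x3 - y3))
      - (y0\<^sup>2 - m * (- x2)\<^sup>2 + m * (x1 - y1) * (x3 + y3))"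
    by (simp add: algebra_simps)
  also have "\<dots> = 0" by (simp only: E(1) E'(1) diff_self)
  finally have "y1 * x3 = x1 * y3" using assms(1) by simp
  moreover have "odd x1" "odd y1" using E(2) par(2,3) by presburger+
  ultimately have "even x3 \<longleftrightarrow> even y3" by (metis even_mult_iff)
  with E(2) show False by simp
qed

text \<open>Norms of at most 4 bound the first form by 2 and \<open>m\<close> times the square of
  the second by 16. Divisibility sharpens these bounds to \<open>S = 0\<close> and to the vanishing
  of both second forms; either parity of \<open>y0\<close> is then contradictory modulo 4.\<close>

lemma odd_no_solution:
  fixes y0 x1 y1 x2 x3 y3 m N N' :: int
  assumes "m mod 4 = 3" "m > 0" "N dvd 4" "N \<noteq> 0" "N' dvd 4" "N' \<noteq> 0"
    and par: "even (y0 + x2)" "even (x1 - y3)" "even (y1 + x3)"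
    and N: "4 * N = 4 * (y0\<^sup>2 - m * x2\<^sup>2 + m * (x1 + y1) * (x3 - y3))\<^sup>2
       + m * (4 * y0 * x2 - (x1 + y1)\<^sup>2 + m * (x3 - y3)\<^sup>2)\<^sup>2"
    and N': "4 * N' = 4 * (y0\<^sup>2 - m * (- x2)\<^sup>2 + m * (x1 - y1) * (x3 + y3))\<^sup>2
       + m * (4 * y0 * (- x2) - (x1 - y1)\<^sup>2 + m * (x3 + y3)\<^sup>2)\<^sup>2"
  shows False
proof -
  have m3: "m \<ge> 3" using assms(1,2) by presburger
  have bound: "\<bar>A\<bar> \<le> 2 \<and> m * B\<^sup>2 \<le> 16" if "4 * n = 4 * A\<^sup>2 + m * B\<^sup>2" "n dvd 4" for n A B :: int
  proof -
    have "n \<le> 4" using dvd_imp_le_int[OF _ that(2)] by simp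
    moreover have "m * B\<^sup>2 \<ge> 0" "A\<^sup>2 \<ge> 0" using m3 by auto
    ultimately have "A\<^sup>2 \<le> 4" "m * B\<^sup>2 \<le> 16" using that(1) by linarith+
    then show ?thesis using abs_le_square_iff[of A 2] by simp
  qed
  define A where "A = y0\<^sup>2 - m * x2\<^sup>2 + m * (x1 + y1) * (x3 - y3)"
  define A' where "A' = y0\<^sup>2 - m * (- x2)\<^sup>2 + m * (x1 - y1) * (x3 + y3)"
  define S where "S = y1 * x3 - x1 * y3"
  note b = bound[OF N assms(3), folded A_def] and b' = bound[OF N' assms(5), folded A'_def]
  have "A - A' = m * (2 * S)" by (simp add: A_def A'_def S_def algebra_simps)
  then have "\<bar>m * (2 * S)\<bar> \<le> 4" using b b' by linarith
  have S: "S = 0"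
  proof (rule ccontr)
    assume "S \<noteq> 0"
    then have "3 * 2 \<le> m * \<bar>2 * S\<bar>" using m3 by (intro mult_mono) auto
    with \<open>\<bar>m * (2 * S)\<bar> \<le> 4\<close> m3 show False by (simp add: abs_mult)
  qed
  then have "y1 * x3 = x1 * y3" by (simp add: S_def)
  \<comment> \<open>By \<open>par\<close>, \<open>y1 * x3\<close> has the parity of
    \<open>y1\<close> and \<open>x1 * y3\<close> that of \<open>x1\<close>. As the products agree,
    all four numbers have the same parity.\<close>
  then have "even y1 \<and> even x3 \<or> odd y1 \<and> odd x3 \<longleftrightarrow> even x1 \<and> even y3 \<or> odd x1 \<and> odd y3"
    using par by auto
  moreover have "even (y1 * x3) \<longleftrightarrow> even (x1 * y3)" using \<open>y1 * x3 = x1 * y3\<close> by simp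
  ultimately have "even (x1 + y1)" "even (x3 - y3)" "even (x1 - y1)" "even (x3 + y3)"
    using par by auto
  then obtain s q s' q' where sq: "x1 + y1 = 2 * s" "x3 - y3 = 2 * q" "x1 - y1 = 2 * s'" "x3 + y3 = 2 * q'"
    by (elim evenE)
  have zero: "C = 0" if "m * (4 * C)\<^sup>2 \<le> 16" for C :: int
  proof (rule ccontr)
    assume "C \<noteq> 0"
    then have "C\<^sup>2 \<ge> 1" by (simp add: int_one_le_iff_zero_less)
    then have "3 * 16 \<le> m * (16 * C\<^sup>2)" using m3 by (intro mult_mono) auto
    with that show False by (simp add: power_mult_distrib)
  qed
  have "4 * y0 * x2 - (x1 + y1)\<^sup>2 + m * (x3 - y3)\<^sup>2 = 4 * (y0 * x2 - s\<^sup>2 + m * q\<^sup>2)"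
    unfolding sq by (simp add: algebra_simps power2_eq_square)
  with zero b have B: "y0 * x2 - s\<^sup>2 + m * q\<^sup>2 = 0" by metis
  have "4 * y0 * (- x2) - (x1 - y1)\<^sup>2 + m * (x3 + y3)\<^sup>2 = 4 * (- (y0 * x2) - s'\<^sup>2 + m * q'\<^sup>2)"
    unfolding sq by (simp add: algebra_simps power2_eq_square)
  with zero b' have B': "- (y0 * x2) - s'\<^sup>2 + m * q'\<^sup>2 = 0" by metis
  define l where "l = m div 4 + 1"
  have l: "m = 4 * l - 1" using assms(1) unfolding l_def by presburger
  have sumsq: "(x\<^sup>2 + y\<^sup>2) mod 4 \<noteq> (3 :: int)" for x y :: int
  proof -
    have "z\<^sup>2 mod 4 = 0 \<or> z\<^sup>2 mod 4 = 1" for z :: int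
    proof (cases "even z")
      case True
      then show ?thesis by (auto simp: power2_eq_square elim!: evenE)
    next
      case False
      then obtain k where "z = 2 * k + 1" ..
      then have "z\<^sup>2 = 1 + 4 * (k\<^sup>2 + k)" by (simp add: power2_eq_square algebra_simps)
      then show ?thesis by (simp only: mod_mult_self2) simp
    qed
    from this[of x] this[of y] show ?thesis by (auto simp: mod_add_eq[symmetric, of "x\<^sup>2"])
  qed
  show False
  proof (cases "even y0")
    case True
    then have "even x2" using par(1) by simp
    \<comment> \<open>Now 4 divides \<open>A\<close>, and \<open>A\<close> is at most 2 in absolute
      value, so \<open>A\<close> vanishes and \<open>N\<close> with it.\<close>
    have "A = y0\<^sup>2 - m * x2\<^sup>2 + 4 * (m * s * q)" by (simp add: A_def sq)
    moreover have "4 dvd y0\<^sup>2" "4 dvd x2\<^sup>2" using True \<open>even x2\<close> by (auto simp: power2_eq_square elim!: evenE)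
    ultimately have "4 dvd A" by simp
    with b have "A = 0" by presburger
    with N B \<open>_ = 4 * (y0 * x2 - s\<^sup>2 + m * q\<^sup>2)\<close> have "N = 0" by (simp add: A_def)
    with assms(4) show False by contradiction
  next
    case False
    then have odd: "odd (y0 * x2)" using par(1) by simp
    \<comment> \<open>As \<open>m\<close> is -1 modulo 4, \<open>y0 * x2\<close> and its negative
      are both sums of two squares modulo 4, hence not 3; but one of an odd number and its negative
      is 3.\<close>
    have "y0 * x2 = s\<^sup>2 + q\<^sup>2 - 4 * (l * q\<^sup>2)" "- (y0 * x2) = s'\<^sup>2 + q'\<^sup>2 - 4 * (l * q'\<^sup>2)"
      using B B' unfolding l by (simp_all add: algebra_simps)
    then have "(y0 * x2) mod 4 = (s\<^sup>2 + q\<^sup>2) mod 4" "(- (y0 * x2)) mod 4 = (s'\<^sup>2 + q'\<^sup>2) mod 4"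
      by (simp_all add: mod_diff_eq[symmetric])
    with sumsq have "(y0 * x2) mod 4 \<noteq> 3" "(- (y0 * x2)) mod 4 \<noteq> 3" by auto
    moreover have "e mod 4 = 3 \<or> (- e) mod 4 = 3" if "odd e" for e :: int
      using that by presburger
    ultimately show False using odd by blast
  qed
qed

section \<open>Parity by reduction modulo \<open>1 + \<i>\<close>\<close>

lemma power4_eq_square_square: "z ^ 4 = (z\<^sup>2)\<^sup>2" for z :: "'a :: monoid_mult"
  by (simp flip: power_mult)

text \<open>The prime \<open>1 + \<i>\<close> above 2 has a residue field of two elements and square
  \<open>2 * \<i>\<close>, so divisibility by it determines squares modulo 2.\<close>

lemma gauss_int_parity_cases:
  assumes "z \<in> gauss_int"
  obtains (even) k where "k \<in> gauss_int" "z = (1 + \<i>) * k" "z\<^sup>2 = 2 * (\<i> * k\<^sup>2)"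
  | (odd) s where "s \<in> gauss_int" "z\<^sup>2 = 1 + 2 * s"
proof -
  obtain x y :: int where z: "z = of_int x + \<i> * of_int y" using assms by (auto simp: gauss_int_iff)
  show thesis
  proof (cases "even (x + y)")
    case True
    then obtain t where t: "x + y = 2 * t" ..
    then have x: "x = 2 * t - y" by simp
    show thesis
    proof (rule even)
      show "of_int t + \<i> * of_int (y - t) \<in> gauss_int" by simp
      show "z = (1 + \<i>) * (of_int t + \<i> * of_int (y - t))" unfolding z x by (simp add: algebra_simps)
      then show "z\<^sup>2 = 2 * (\<i> * (of_int t + \<i> * of_int (y - t))\<^sup>2)"
        by (simp add: power_mult_distrib power2_sum)
    qed
  next
    case False
    then obtain t where t: "x + y = 2 * t + 1" by (elim oddE)
    then have x: "x = 2 * t + 1 - y" by simp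
    show thesis
    proof (rule odd)
      show "of_int (2 * t\<^sup>2 + 2 * t - 2 * t * y - y) + \<i> * of_int (x * y) \<in> gauss_int" by simp
      show "z\<^sup>2 = 1 + 2 * (of_int (2 * t\<^sup>2 + 2 * t - 2 * t * y - y) + \<i> * of_int (x * y))"
        unfolding z x by (simp add: algebra_simps power2_eq_square)
    qed
  qed
qed

lemma odd_half_not_gauss_int: "odd k \<Longrightarrow> of_int k / 2 \<notin> gauss_int"
  using dvd_parts_if_gauss_int(1)[of k 0 2] by auto

lemma gauss_int_even_parts:
  assumes "k \<in> gauss_int" "of_int x + \<i> * of_int y = 2 * k"
  shows "even x" "even y"
  using dvd_parts_if_gauss_int[of x y 2] assms by auto

text \<open>The hypotheses are the norm data of an integral
  \<open>g / 2 + (h / 2) * \<theta>\<close>. The factor \<open>1 + \<i>\<close> is extracted twice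
  from both \<open>g\<close> and \<open>h\<close>, which amounts to a factor 2.\<close>

lemma odd_lattice_parity:
  fixes x0 y0 x1 y1 :: int and m :: nat
  defines "g \<equiv> of_int x0 + \<i> * of_int y0" and "h \<equiv> of_int x1 + \<i> * of_int y1"
  assumes m: "m mod 4 = 3"
    and sq: "g\<^sup>2 / 2 \<in> gauss_int" and norm: "(g ^ 4 - of_nat m * h ^ 4) / 16 \<in> gauss_int"
  shows "even x0" "even y0" "even x1" "even y1"
proof -
  have gh: "g \<in> gauss_int" "h \<in> gauss_int" by (auto simp: g_def h_def)
  obtain k where k: "k \<in> gauss_int" "g = (1 + \<i>) * k" "g\<^sup>2 = 2 * (\<i> * k\<^sup>2)"
  proof (cases rule: gauss_int_parity_cases[OF gh(1)])
    case (2 s)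
    have "g\<^sup>2 / 2 - s = of_int 1 / 2" unfolding 2(2) by (simp add: add_divide_distrib)
    moreover have "g\<^sup>2 / 2 - s \<in> gauss_int" by (rule gauss_int_arith(2)[OF sq 2(1)])
    ultimately have "of_int 1 / 2 \<in> gauss_int" by (simp only:)
    with odd_half_not_gauss_int[OF odd_one] show ?thesis by contradiction
  qed (use that in blast)
  have g4: "g ^ 4 = - 4 * k ^ 4"
    by (simp only: power4_eq_square_square k(3)) (simp add: power_mult_distrib)
  have four: "of_int a \<noteq> (4 * w :: complex)" if "\<not> 4 dvd a" "w \<in> gauss_int" for a w
    using dvd_parts_if_gauss_int(1)[of a 0 4] that by auto
  define w where "w = (g ^ 4 - of_nat m * h ^ 4) / 16"
  have w: "w \<in> gauss_int" "g ^ 4 - of_nat m * h ^ 4 = 16 * w"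
    using norm by (simp_all add: w_def)
  obtain l where l: "l \<in> gauss_int" "h = (1 + \<i>) * l" "h\<^sup>2 = 2 * (\<i> * l\<^sup>2)"
  proof (cases rule: gauss_int_parity_cases[OF gh(2)])
    case (2 s)
    have h4: "h ^ 4 = 1 + 4 * (s + s\<^sup>2)"
      by (simp only: power4_eq_square_square 2(2)) (simp add: power2_eq_square algebra_simps)
    \<comment> \<open>If \<open>h\<close> were odd, its fourth power would be 1 modulo 4, while 4
      divides \<open>g ^ 4\<close>; so 4 would divide \<open>m\<close>.\<close>
    have "of_int (int m) = 4 * (- (k ^ 4) - of_nat m * (s + s\<^sup>2) - 4 * w)"
      using w(2) unfolding h4 g4 by (simp add: algebra_simps)
    moreover have "- (k ^ 4) - of_nat m * (s + s\<^sup>2) - 4 * w \<in> gauss_int"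
      using 2 k w by (intro gauss_int_arith gauss_int_unary gauss_int_const)
    moreover have "\<not> 4 dvd int m" using m by presburger
    ultimately show ?thesis using four by blast
  qed (use that in blast)
  have h4: "h ^ 4 = - 4 * l ^ 4"
    by (simp only: power4_eq_square_square l(3)) (simp add: power_mult_distrib)
  have "4 * (of_nat m * l ^ 4 - k ^ 4) = 4 * (4 * w)"
    using w(2) unfolding g4 h4 by (simp add: algebra_simps)
  then have w': "of_nat m * l ^ 4 - k ^ 4 = 4 * w"
    by (rule mult_left_cancel[THEN iffD1, rotated]) simp
  \<comment> \<open>Second round: the fourth power is 0 or 1 modulo 4, and this residue
    \<open>e\<close> detects divisibility by \<open>1 + \<i>\<close>.\<close>
  have fourth: "\<exists>s\<in>gauss_int. z ^ 4 = of_int e + 4 * s \<and> (e = 0 \<and> (\<exists>k\<in>gauss_int. z = (1 + \<i>) * k) \<or> e = 1)"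
    if "z \<in> gauss_int" and "e = (if \<exists>k\<in>gauss_int. z = (1 + \<i>) * k then 0 else 1)" for z and e :: int
  proof (cases rule: gauss_int_parity_cases[OF that(1)])
    case (1 k)
    have "z ^ 4 = 4 * (- (k ^ 4))"
    by (simp only: power4_eq_square_square 1(3)) (simp add: power_mult_distrib)
    moreover have "e = 0" using that(2) 1 by auto
    ultimately show ?thesis using 1 by (intro bexI[of _ "- (k ^ 4)"]) auto
  next
    case (2 s)
    have z4: "z ^ 4 = 1 + 4 * (s + s\<^sup>2)"
      by (simp only: power4_eq_square_square 2(2)) (simp add: power2_eq_square algebra_simps)
    have "\<not> (\<exists>k\<in>gauss_int. z = (1 + \<i>) * k)"
    proof
      assume "\<exists>k\<in>gauss_int. z = (1 + \<i>) * k"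
      then obtain k where "k \<in> gauss_int" "z = (1 + \<i>) * k" by blast
      then have "z\<^sup>2 = 2 * (\<i> * k\<^sup>2)" by (simp add: power_mult_distrib power2_sum)
      then have "of_int 1 / 2 = \<i> * k\<^sup>2 - s" unfolding 2(2) by (simp add: field_simps)
      moreover have "\<i> * k\<^sup>2 - s \<in> gauss_int" using 2 \<open>k \<in> gauss_int\<close> by simp
      ultimately have "of_int 1 / 2 \<in> gauss_int" by (simp only:)
      with odd_half_not_gauss_int[OF odd_one] show False by contradiction
    qed
    then show ?thesis using z4 that(2) 2 by (intro bexI[of _ "s + s\<^sup>2"]) auto
  qed
  obtain s e where e: "s \<in> gauss_int" "k ^ 4 = of_int e + 4 * s"
      "e = 0 \<and> (\<exists>j\<in>gauss_int. k = (1 + \<i>) * j) \<or> e = (1 :: int)"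
    using fourth[OF k(1) refl] by blast
  obtain t f where f: "t \<in> gauss_int" "l ^ 4 = of_int f + 4 * t"
      "f = 0 \<and> (\<exists>j\<in>gauss_int. l = (1 + \<i>) * j) \<or> f = (1 :: int)"
    using fourth[OF l(1) refl] by blast
  have "of_int (int m * f - e) = 4 * (w + s - of_nat m * t)"
    using w' unfolding e f by (simp add: algebra_simps)
  moreover have "w + s - of_nat m * t \<in> gauss_int" using w e f by simp
  ultimately have "4 dvd int m * f - e" using four by blast
  moreover have "\<not> 4 dvd int m" "\<not> 4 dvd int m - 1" using m by presburger+
  ultimately have "e = 0" "f = 0" using e(3) f(3) by auto
  then obtain i j where ij: "i \<in> gauss_int" "k = (1 + \<i>) * i" "j \<in> gauss_int" "l = (1 + \<i>) * j"
    using e(3) f(3) by auto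
  have "(1 + \<i>) * ((1 + \<i>) * u) = 2 * (\<i> * u)" for u by (simp add: algebra_simps)
  then have "g = 2 * (\<i> * i)" "h = 2 * (\<i> * j)" using k l ij by simp_all
  then show "even x0" "even y0" "even x1" "even y1"
    using gauss_int_even_parts[of "\<i> * i"] gauss_int_even_parts[of "\<i> * j"] ij
    by (auto simp: g_def h_def)
qed

text \<open>The same double extraction for the radicand \<open>2 * n\<close> and an element with
  third coordinate \<open>c / 2\<close>, whose residue \<open>e\<close> takes part in the second
  round.\<close>

lemma even_lattice_parity:
  fixes x0 y0 x1 y1 n :: int
  defines "g \<equiv> of_int x0 + \<i> * of_int y0" and "h \<equiv> of_int x1 + \<i> * of_int y1"
  assumes n: "odd n" and c: "c \<in> gauss_int"
    and sq: "(g\<^sup>2 + 2 * of_int n * c\<^sup>2) / 2 \<in> gauss_int"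
    and norm: "((g\<^sup>2 + 2 * of_int n * c\<^sup>2)\<^sup>2 - 2 * of_int n * (2 * g * c - h\<^sup>2)\<^sup>2) / 16 \<in> gauss_int"
  shows "even x0" "even y0" "even x1" "even y1"
proof -
  have gh: "g \<in> gauss_int" "h \<in> gauss_int" by (auto simp: g_def h_def)
  obtain k where k: "k \<in> gauss_int" "g = (1 + \<i>) * k" "g\<^sup>2 = 2 * (\<i> * k\<^sup>2)"
  proof (cases rule: gauss_int_parity_cases[OF gh(1)])
    case (2 s)
    have "(g\<^sup>2 + 2 * of_int n * c\<^sup>2) / 2 - s - of_int n * c\<^sup>2 = of_int 1 / 2"
      unfolding 2(2) by (simp add: add_divide_distrib)
    moreover have "(g\<^sup>2 + 2 * of_int n * c\<^sup>2) / 2 - s - of_int n * c\<^sup>2 \<in> gauss_int"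
      using sq 2 c by (intro gauss_int_arith gauss_int_unary gauss_int_const)
    ultimately have "of_int 1 / 2 \<in> gauss_int" by (simp only:)
    with odd_half_not_gauss_int[OF odd_one] show ?thesis by contradiction
  qed (use that in blast)
  define w where "w = ((g\<^sup>2 + 2 * of_int n * c\<^sup>2)\<^sup>2 - 2 * of_int n * (2 * g * c - h\<^sup>2)\<^sup>2) / 16"
  have w: "w \<in> gauss_int" "(g\<^sup>2 + 2 * of_int n * c\<^sup>2)\<^sup>2 - 2 * of_int n * (2 * g * c - h\<^sup>2)\<^sup>2 = 16 * w"
    using norm by (auto simp: w_def)
  obtain l where l: "l \<in> gauss_int" "h = (1 + \<i>) * l" "h\<^sup>2 = 2 * (\<i> * l\<^sup>2)"
  proof (cases rule: gauss_int_parity_cases[OF gh(2)])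
    case (2 s)
    \<comment> \<open>For odd \<open>h\<close>, half of the norm equation exhibits \<open>n\<close>
      as twice a Gaussian integer.\<close>
    define u v where "u = \<i> * k\<^sup>2 + of_int n * c\<^sup>2" and "v = g * c - s"
    have "2 * g * c - (1 + 2 * s) = 2 * v - 1" "2 * (\<i> * k\<^sup>2) + 2 * of_int n * c\<^sup>2 = 2 * u"
      by (simp_all add: u_def v_def algebra_simps)
    then have "(2 * u)\<^sup>2 - 2 * of_int n * (2 * v - 1)\<^sup>2 = 16 * w"
      using w(2) unfolding k(3) 2(2) by (simp only:)
    then have "2 * of_int n = 2 * (2 * (u\<^sup>2 - 4 * w - 2 * of_int n * (v\<^sup>2 - v)))"
      by (simp add: power2_eq_square algebra_simps)
    then have "of_int n = 2 * (u\<^sup>2 - 4 * w - 2 * of_int n * (v\<^sup>2 - v))"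
      by (rule mult_left_cancel[THEN iffD1, rotated]) simp
    moreover have "x / 2 = z" if "x = 2 * z" for x z :: complex
      using that by simp
    ultimately have "of_int n / 2 = u\<^sup>2 - 4 * w - 2 * of_int n * (v\<^sup>2 - v)" by blast
    moreover have "u\<^sup>2 - 4 * w - 2 * of_int n * (v\<^sup>2 - v) \<in> gauss_int"
      unfolding u_def v_def using w c k 2 gh
      by (intro gauss_int_arith gauss_int_unary gauss_int_const)
    ultimately have "of_int n / 2 \<in> gauss_int" by (simp only:)
    with odd_half_not_gauss_int[OF n] show ?thesis by contradiction
  qed (use that in blast)
  have sqr: "\<exists>s\<in>gauss_int. \<exists>e :: int. z\<^sup>2 = of_int e + 2 * s \<and>
      (e = 0 \<and> (\<exists>k\<in>gauss_int. z = (1 + \<i>) * k) \<or> e = 1)" if "z \<in> gauss_int" for z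
  proof (cases rule: gauss_int_parity_cases[OF that])
    case (1 k)
    then show ?thesis by (intro bexI[of _ "\<i> * k\<^sup>2"] exI[of _ 0]) auto
  next
    case (2 s)
    then show ?thesis by (intro bexI[of _ s] exI[of _ 1]) auto
  qed
  obtain r d where d: "r \<in> gauss_int" "k\<^sup>2 = of_int d + 2 * r"
      "d = 0 \<and> (\<exists>j\<in>gauss_int. k = (1 + \<i>) * j) \<or> d = (1 :: int)"
    using sqr[OF k(1)] by blast
  obtain s e where e: "s \<in> gauss_int" "c\<^sup>2 = of_int e + 2 * s" "e = 0 \<or> e = (1 :: int)"
    using sqr[OF c] by blast
  obtain t f where f: "t \<in> gauss_int" "l\<^sup>2 = of_int f + 2 * t"
      "f = 0 \<and> (\<exists>j\<in>gauss_int. l = (1 + \<i>) * j) \<or> f = (1 :: int)"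
    using sqr[OF l(1)] by blast
  \<comment> \<open>\<open>P\<close> is half of \<open>g\<^sup>2 + 2 * n * c\<^sup>2\<close> up to
    the even part \<open>2 * P'\<close>, and \<open>R\<close> is \<open>g * c\<close>. As 2 divides
    \<open>R\<^sup>2\<close>, only \<open>P\<^sup>2\<close> and \<open>2 * n * f\<^sup>2\<close>
    survive modulo 4.\<close>
  define P where "P = \<i> * of_int d + of_int n * of_int e"
  define P' where "P' = \<i> * r + of_int n * s"
  define R where "R = (1 + \<i>) * k * c"
  have "R\<^sup>2 = 2 * (\<i> * k\<^sup>2 * c\<^sup>2)" by (simp add: R_def power_mult_distrib power2_sum)
  have "4 * (4 * w) = 4 * ((P + 2 * P')\<^sup>2 - 2 * of_int n * (R - \<i> * (of_int f + 2 * t))\<^sup>2)"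
  proof -
    have "g\<^sup>2 + 2 * of_int n * c\<^sup>2 = 2 * (P + 2 * P')"
      unfolding k(3) d(2) e(2) P_def P'_def by (simp add: algebra_simps)
    moreover have "2 * g * c - h\<^sup>2 = 2 * (R - \<i> * (of_int f + 2 * t))"
      unfolding l(3) f(2) R_def k(2) by (simp add: algebra_simps)
    ultimately have "16 * w = (2 * (P + 2 * P'))\<^sup>2 - 2 * of_int n * (2 * (R - \<i> * (of_int f + 2 * t)))\<^sup>2"
      using w(2) by (simp only:)
    then show ?thesis by (simp only: power_mult_distrib) (simp add: algebra_simps)
  qed
  then have "4 * w = (P + 2 * P')\<^sup>2 - 2 * of_int n * (R - \<i> * (of_int f + 2 * t))\<^sup>2"
    by (rule mult_left_cancel[THEN iffD1, rotated]) simp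
  also have "\<dots> = P\<^sup>2 + 4 * (P * P' + P'\<^sup>2) - 2 * of_int n * (R\<^sup>2 - 2 * R * \<i> * (of_int f + 2 * t)
      - (of_int f)\<^sup>2 - 4 * (of_int f * t + t\<^sup>2))"
    by (simp add: power2_eq_square algebra_simps)
  finally have "P\<^sup>2 + 2 * of_int n * (of_int f)\<^sup>2 = 4 * (w - (P * P' + P'\<^sup>2) + of_int n *
      (\<i> * k\<^sup>2 * c\<^sup>2 - R * \<i> * (of_int f + 2 * t) - 2 * (of_int f * t + t\<^sup>2)))"
    unfolding \<open>R\<^sup>2 = _\<close> by (simp add: algebra_simps)
  moreover have "P\<^sup>2 + 2 * of_int n * (of_int f)\<^sup>2 =
      of_int (n\<^sup>2 * e\<^sup>2 - d\<^sup>2 + 2 * n * f\<^sup>2) + \<i> * of_int (2 * (n * (d * e)))"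
    by (simp add: P_def power2_eq_square algebra_simps)
  moreover have "w - (P * P' + P'\<^sup>2) + of_int n *
      (\<i> * k\<^sup>2 * c\<^sup>2 - R * \<i> * (of_int f + 2 * t) - 2 * (of_int f * t + t\<^sup>2)) \<in> gauss_int"
    unfolding P_def P'_def R_def using w c k d e f by (intro gauss_int_arith gauss_int_unary gauss_int_const)
  ultimately have "(of_int (n\<^sup>2 * e\<^sup>2 - d\<^sup>2 + 2 * n * f\<^sup>2) + \<i> * of_int (2 * (n * (d * e)))) / of_int 4 \<in> gauss_int"
    by simp
  from dvd_parts_if_gauss_int[OF this]
  have dvd: "4 dvd n\<^sup>2 * e\<^sup>2 - d\<^sup>2 + 2 * n * f\<^sup>2" "4 dvd 2 * (n * (d * e))" by simp_all
  have "even x" if "4 dvd x" for x :: int using that by presburger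
  moreover have "odd (n\<^sup>2)" "odd (n\<^sup>2 + 2 * n)" "odd (2 * n - 1)" using n by auto
  ultimately have "\<not> 4 dvd n\<^sup>2" "\<not> 4 dvd n\<^sup>2 + 2 * n" "\<not> 4 dvd 2 * n - 1" by blast+
  moreover have "\<not> 4 dvd 2 * n" using n by presburger
  \<comment> \<open>The imaginary part excludes \<open>d = e = 1\<close>; the real part excludes the
    other cases with \<open>d\<close> or \<open>f\<close> nonzero.\<close>
  ultimately have "d = 0" "f = 0" using dvd d(3) e(3) f(3) by auto
  then obtain i j where ij: "i \<in> gauss_int" "k = (1 + \<i>) * i" "j \<in> gauss_int" "l = (1 + \<i>) * j"
    using d(3) f(3) by auto
  have "(1 + \<i>) * ((1 + \<i>) * u) = 2 * (\<i> * u)" for u by (simp add: algebra_simps)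
  then have "g = 2 * (\<i> * i)" "h = 2 * (\<i> * j)" using k l ij by simp_all
  then show "even x0" "even y0" "even x1" "even y1"
    using gauss_int_even_parts[of "\<i> * i"] gauss_int_even_parts[of "\<i> * j"] ij
    by (auto simp: g_def h_def)
qed

section \<open>The field\<close>

lemma norms_in_gauss_rat:
  assumes "a \<in> gauss_rat" "b \<in> gauss_rat" "c \<in> gauss_rat" "d \<in> gauss_rat"
  shows "norm_fst (of_nat m) a b c d \<in> gauss_rat" "norm_snd (of_nat m) a b c d \<in> gauss_rat"
  using assms by (auto simp: norm_fst_def norm_snd_def intro!: gauss_rat_arith gauss_rat_unary gauss_rat_const)

lemma cubic_mult:
  assumes "z ^ 4 = n"
  shows "cubic a b c d z * cubic a' b' c' d' z =
    cubic (a * a' + n * (b * d' + c * c' + d * b')) (a * b' + b * a' + n * (c * d' + d * c'))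
      (a * c' + b * b' + c * a' + n * d * d') (a * d' + b * c' + c * b' + d * a') z"
  unfolding cubic_def assms[symmetric]
  by (simp add: power2_eq_square power3_eq_cube power4_eq_xxxx algebra_simps)

lemma cubic_add: "cubic a b c d z + cubic a' b' c' d' z = cubic (a + a') (b + b') (c + c') (d + d') z"
  by (simp add: cubic_def algebra_simps)

lemma cubic_minus: "- cubic a b c d z = cubic (- a) (- b) (- c) (- d) z"
  by (simp add: cubic_def)

lemma cubic_diff: "cubic a b c d z - cubic a' b' c' d' z = cubic (a - a') (b - b') (c - c') (d - d') z"
  by (simp add: cubic_def algebra_simps)

lemma cubic_scale: "k * cubic a b c d z = cubic (k * a) (k * b) (k * c) (k * d) z"
  by (simp add: cubic_def algebra_simps)

lemma cnj_cubic: "cnj (cubic a b c d z) = cubic (cnj a) (cnj b) (cnj c) (cnj d) (cnj z)"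
  by (simp add: cubic_def)

lemma cubic_const: "cubic a 0 0 0 z = a"
  by (simp add: cubic_def)

lemma cubic_minus_arg: "cubic a b c d (- z) = cubic a (- b) c (- d) z"
  by (simp add: cubic_def)

lemma cubic_ii_arg: "cubic a b c d (\<i> * z) = cubic a (\<i> * b) (- c) (- \<i> * d) z"
  by (simp add: cubic_def power2_eq_square power3_eq_cube algebra_simps)

section \<open>Linear independence of the powers of \<theta>\<close>

locale quartic =
  fixes m :: nat and \<theta> :: real
  assumes theta_pos: "\<theta> > 0" and theta_4: "\<theta> ^ 4 = real m"
    and squarefree_m: "squarefree m" and m_mod_4: "[m = 2] (mod 4) \<or> [m = 3] (mod 4)"
begin

lemma m_gt_1: "m > 1"
  using m_mod_4 by (cases "m = 0 \<or> m = 1") (auto simp: cong_def)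

lemma theta_square_irrational: "\<theta>\<^sup>2 \<notin> \<rat>"
proof
  assume rat: "\<theta>\<^sup>2 \<in> \<rat>"
  have eq: "real m = (\<theta>\<^sup>2)\<^sup>2" using theta_4 by (simp flip: power_mult)
  \<comment> \<open>Division by \<open>m\<close> gives \<open>m * r\<^sup>2 = 1\<close>, so that
    square-freeness makes \<open>r\<close> an integer.\<close>
  obtain r where r: "r \<in> \<rat>" "r = \<theta>\<^sup>2 / real m" using rat by auto
  have "r\<^sup>2 = (\<theta>\<^sup>2)\<^sup>2 / (real m)\<^sup>2" by (simp only: r(2) power_divide)
  then have "real m * r\<^sup>2 = 1" using m_gt_1 unfolding eq[symmetric] by (simp add: power2_eq_square)
  then have "r \<in> \<int>" using rat_times_square_Int[of r m] r(1) squarefree_m by simp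
  then obtain k where "r = of_int k" by (auto elim: Ints_cases)
  then have "real_of_int (int m * k\<^sup>2) = 1" using \<open>real m * r\<^sup>2 = 1\<close> by simp
  then have "int m * k\<^sup>2 = 1" by linarith
  then have "int m dvd 1" by (metis dvd_triv_left)
  then show False using m_gt_1 by simp
qed

lemma rat_sqrt_indep:
  assumes "u \<in> \<rat>" "v \<in> \<rat>" "u + v * \<theta>\<^sup>2 = 0"
  shows "u = 0 \<and> v = 0"
proof -
  have "v = 0"
  proof (rule ccontr)
    assume "v \<noteq> 0"
    then have "\<theta>\<^sup>2 = - u / v" using assms(3) by (simp add: field_simps)
    with assms theta_square_irrational show False by simp
  qed
  with assms show ?thesis by simp
qed

text \<open>If \<open>b + d * \<theta>\<^sup>2\<close> is nonzero, the relation puts \<theta> into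
  Q(\<theta>^2). Squaring \<open>\<theta> = u + v * \<theta>\<^sup>2\<close> and comparing rational
  parts gives \<open>u\<^sup>2 + m * v\<^sup>2 = 0\<close>, hence \<theta> = 0. Otherwise the
  relation splits into two over Q(\<theta>^2).\<close>

lemma rat_cubic_indep:
  assumes rat: "a \<in> \<rat>" "b \<in> \<rat>" "c \<in> \<rat>" "d \<in> \<rat>" and zero: "cubic a b c d \<theta> = 0"
  shows "a = 0 \<and> b = 0 \<and> c = 0 \<and> d = 0"
proof -
  have t2: "(\<theta>\<^sup>2)\<^sup>2 = real m" using theta_4 by (simp flip: power_mult)
  have eq: "a + c * \<theta>\<^sup>2 = - \<theta> * (b + d * \<theta>\<^sup>2)"
    using zero by (simp add: cubic_def algebra_simps power2_eq_square power3_eq_cube)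
  have "b + d * \<theta>\<^sup>2 = 0"
  proof (rule ccontr)
    assume "b + d * \<theta>\<^sup>2 \<noteq> 0"
    moreover have "b - d * \<theta>\<^sup>2 \<noteq> 0"
      using rat_sqrt_indep[of b "- d"] rat \<open>b + d * \<theta>\<^sup>2 \<noteq> 0\<close> by auto
    moreover have "(b + d * \<theta>\<^sup>2) * (b - d * \<theta>\<^sup>2) = b\<^sup>2 - d\<^sup>2 * (\<theta>\<^sup>2)\<^sup>2"
      by (simp add: algebra_simps power2_eq_square)
    ultimately have "b\<^sup>2 - d\<^sup>2 * (\<theta>\<^sup>2)\<^sup>2 \<noteq> 0" by (metis mult_eq_0_iff)
    then have nz: "b\<^sup>2 - real m * d\<^sup>2 \<noteq> 0" unfolding t2 mult.commute[of "d\<^sup>2"] .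
    \<comment> \<open>Solve for \<theta> and rationalize the denominator with
      \<open>b - d * \<theta>\<^sup>2\<close>.\<close>
    define u where "u = (real m * c * d - a * b) / (b\<^sup>2 - real m * d\<^sup>2)"
    define v where "v = (a * d - b * c) / (b\<^sup>2 - real m * d\<^sup>2)"
    have uv: "u \<in> \<rat>" "v \<in> \<rat>" using rat by (auto simp: u_def v_def)
    have "\<theta> * (b\<^sup>2 - real m * d\<^sup>2) = - (- \<theta> * (b + d * \<theta>\<^sup>2)) * (b - d * \<theta>\<^sup>2)"
      by (simp add: algebra_simps power2_eq_square flip: t2)
    also have "\<dots> = (real m * c * d - a * b) + (a * d - b * c) * \<theta>\<^sup>2"
      unfolding eq[symmetric] t2[symmetric] by (simp add: algebra_simps power2_eq_square)
    finally have "\<theta> = ((real m * c * d - a * b) + (a * d - b * c) * \<theta>\<^sup>2) / (b\<^sup>2 - real m * d\<^sup>2)"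
      by (simp only: nonzero_eq_divide_eq[OF nz])
    then have theta: "\<theta> = u + v * \<theta>\<^sup>2"
      by (simp add: u_def v_def add_divide_distrib)
    have "\<theta>\<^sup>2 = (u + v * \<theta>\<^sup>2)\<^sup>2" using theta by simp
    also have "\<dots> = u\<^sup>2 + real m * v\<^sup>2 + 2 * u * v * \<theta>\<^sup>2"
      unfolding t2[symmetric] by (simp add: algebra_simps power2_eq_square)
    finally have "(u\<^sup>2 + real m * v\<^sup>2) + (2 * u * v - 1) * \<theta>\<^sup>2 = 0"
      by (simp add: algebra_simps)
    then have "u\<^sup>2 + real m * v\<^sup>2 = 0"
      using rat_sqrt_indep[of "u\<^sup>2 + real m * v\<^sup>2" "2 * u * v - 1"] uv by simp
    moreover have "u\<^sup>2 \<ge> 0" "real m * v\<^sup>2 \<ge> 0" by auto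
    ultimately have "u\<^sup>2 = 0" "real m * v\<^sup>2 = 0" by linarith+
    then have "u = 0" "v = 0" using m_gt_1 by auto
    then show False using theta theta_pos by simp
  qed
  with eq have "a + c * \<theta>\<^sup>2 = 0" by simp
  with \<open>b + d * \<theta>\<^sup>2 = 0\<close> rat_sqrt_indep rat show ?thesis by blast
qed

abbreviation \<Theta> :: complex where "\<Theta> \<equiv> complex_of_real \<theta>"

lemma Theta_4: "\<Theta> ^ 4 = of_nat m"
  using theta_4 by (metis of_real_of_nat_eq of_real_power)

text \<open>As \<theta> is real, real and imaginary parts reduce this to rational
  coefficients.\<close>

lemma gauss_cubic_indep:
  assumes "a \<in> gauss_rat" "b \<in> gauss_rat" "c \<in> gauss_rat" "d \<in> gauss_rat"
    and zero: "cubic a b c d \<Theta> = 0"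
  shows "a = 0 \<and> b = 0 \<and> c = 0 \<and> d = 0"
proof -
  have "Re (cubic a b c d \<Theta>) = cubic (Re a) (Re b) (Re c) (Re d) \<theta>"
    "Im (cubic a b c d \<Theta>) = cubic (Im a) (Im b) (Im c) (Im d) \<theta>"
    by (simp_all add: cubic_def flip: of_real_power)
  with assms rat_cubic_indep[of "Re a" "Re b" "Re c" "Re d"] rat_cubic_indep[of "Im a" "Im b" "Im c" "Im d"]
  show ?thesis by (auto simp: gauss_rat_def complex_eq_iff)
qed

lemma gauss_cubic_eq:
  assumes "a \<in> gauss_rat" "b \<in> gauss_rat" "c \<in> gauss_rat" "d \<in> gauss_rat"
    and "a' \<in> gauss_rat" "b' \<in> gauss_rat" "c' \<in> gauss_rat" "d' \<in> gauss_rat"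
    and "cubic a b c d \<Theta> = cubic a' b' c' d' \<Theta>"
  shows "a = a' \<and> b = b' \<and> c = c' \<and> d = d'"
  using gauss_cubic_indep[of "a - a'" "b - b'" "c - c'" "d - d'"] assms
  by (simp flip: cubic_diff)

section \<open>An explicit form of the field\<close>

definition quartic_field :: "complex set" where
  "quartic_field = {cubic a b c d \<Theta> | a b c d. a \<in> gauss_rat \<and> b \<in> gauss_rat \<and> c \<in> gauss_rat \<and> d \<in> gauss_rat}"

lemma quartic_fieldI:
  "a \<in> gauss_rat \<Longrightarrow> b \<in> gauss_rat \<Longrightarrow> c \<in> gauss_rat \<Longrightarrow> d \<in> gauss_rat \<Longrightarrow> cubic a b c d \<Theta> \<in> quartic_field"
  unfolding quartic_field_def by blast

lemma quartic_fieldE: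
  assumes "x \<in> quartic_field"
  obtains a b c d where "a \<in> gauss_rat" "b \<in> gauss_rat" "c \<in> gauss_rat" "d \<in> gauss_rat" "x = cubic a b c d \<Theta>"
  using assms unfolding quartic_field_def by blast

lemma quartic_field_arith:
  assumes "x \<in> quartic_field" "y \<in> quartic_field"
  shows "x + y \<in> quartic_field" "x * y \<in> quartic_field"
  using assms by (elim quartic_fieldE; simp add: cubic_add cubic_mult[OF Theta_4] quartic_fieldI)+

lemma quartic_field_minus: "x \<in> quartic_field \<Longrightarrow> - x \<in> quartic_field"
  by (elim quartic_fieldE) (simp add: cubic_minus quartic_fieldI)

lemma quartic_field_cnj: "x \<in> quartic_field \<Longrightarrow> cnj x \<in> quartic_field"
  by (elim quartic_fieldE) (simp add: cnj_cubic quartic_fieldI)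

lemma gauss_rat_in_quartic_field: "x \<in> gauss_rat \<Longrightarrow> x \<in> quartic_field"
  using quartic_fieldI[of x 0 0 0] by (simp add: cubic_const)

text \<open>The conjugates of \<open>\<Theta>\<close> over Q(i). Evaluating
  \<open>cubic a b c d\<close> at them stands for applying the automorphisms that fix
  \<open>\<i>\<close>.\<close>

definition roots :: "complex set" where "roots = {\<Theta>, - \<Theta>, \<i> * \<Theta>, - (\<i> * \<Theta>)}"

lemma roots_power_4: "z \<in> roots \<Longrightarrow> z ^ 4 = of_nat m"
  by (auto simp: roots_def Theta_4 power_mult_distrib)

lemma cubic_roots_in_quartic_field:
  assumes "a \<in> gauss_rat" "b \<in> gauss_rat" "c \<in> gauss_rat" "d \<in> gauss_rat" "z \<in> roots"
  shows "cubic a b c d z \<in> quartic_field"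
  using assms(5) unfolding roots_def
  by (auto simp: cubic_minus_arg cubic_ii_arg assms(1-4) intro!: quartic_fieldI)

text \<open>The inverse is the product of the three other conjugates divided by the norm, which is a
  nonzero Gaussian rational.\<close>

lemma quartic_field_inverse:
  assumes "x \<in> quartic_field"
  shows "inverse x \<in> quartic_field"
proof (cases "x = 0")
  case True
  then show ?thesis using assms by simp
next
  case False
  obtain a b c d where abcd: "a \<in> gauss_rat" "b \<in> gauss_rat" "c \<in> gauss_rat" "d \<in> gauss_rat"
    and x: "x = cubic a b c d \<Theta>" using assms by (elim quartic_fieldE)
  define y where "y = cubic a b c d (- \<Theta>) * (cubic a b c d (\<i> * \<Theta>) * cubic a b c d (- (\<i> * \<Theta>)))"
  define n where "n = norm_fst (of_nat m) a b c d ^ 2 - of_nat m * norm_snd (of_nat m) a b c d ^ 2"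
  have xy: "x * y = n"
    using cubic_norm[OF Theta_4] by (simp add: x y_def n_def mult.assoc)
  have "cubic a b c d z \<noteq> 0" if "z \<in> roots" for z
  proof
    assume "cubic a b c d z = 0"
    then have "a = 0 \<and> b = 0 \<and> c = 0 \<and> d = 0"
      using that abcd gauss_cubic_indep[of a b c d] gauss_cubic_indep[of a "- b" c "- d"]
        gauss_cubic_indep[of a "\<i> * b" "- c" "- \<i> * d"] gauss_cubic_indep[of a "- (\<i> * b)" "- c" "\<i> * d"]
      unfolding roots_def by (auto simp: cubic_minus_arg cubic_ii_arg)
    with False x show False by (simp add: cubic_def)
  qed
  then have "y \<noteq> 0" by (simp add: y_def roots_def)
  with xy False have "n \<noteq> 0" by auto
  then have "inverse x = y * inverse n" using xy \<open>y \<noteq> 0\<close> False by (auto simp: field_simps)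
  moreover have "y \<in> quartic_field"
    unfolding y_def using abcd
    by (intro quartic_field_arith cubic_roots_in_quartic_field) (auto simp: roots_def)
  moreover have "inverse n \<in> gauss_rat"
    unfolding n_def using norms_in_gauss_rat[OF abcd] by simp
  ultimately show ?thesis by (simp add: quartic_field_arith gauss_rat_in_quartic_field)
qed

lemma rat_adjoin_eq: "rat_adjoin {\<i>, \<Theta>} = quartic_field"
proof (intro equalityI subsetI)
  fix x assume "x \<in> rat_adjoin {\<i>, \<Theta>}"
  then have "x \<in> generate_field complex_field (\<rat> \<union> {\<i>, \<Theta>})" by (simp add: rat_adjoin_def)
  then show "x \<in> quartic_field"
  proof induction
    case one
    show ?case using gauss_rat_in_quartic_field[of 1] by (simp add: ring_of_type_algebra_def)
  next
    case (incl h)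
    then consider "h \<in> \<rat>" | "h = \<i>" | "h = \<Theta>" by blast
    then show ?case
    proof cases
      case 1
      then have "h \<in> gauss_rat" by (auto simp: gauss_rat_def elim!: Rats_cases')
      then show ?thesis by (rule gauss_rat_in_quartic_field)
    next
      case 2
      then show ?thesis by (simp add: gauss_rat_in_quartic_field)
    next
      case 3
      then show ?thesis using quartic_fieldI[of 0 1 0 0] by (simp add: cubic_def)
    qed
  next
    case (a_inv h)
    then show ?case by (simp add: a_inv_complex_field quartic_field_minus)
  next
    case (m_inv h)
    interpret C: field complex_field by (rule field_from_type_algebra)
    have "h \<noteq> 0" using m_inv by (simp add: ring_of_type_algebra_def)
    then have "inv\<^bsub>complex_field\<^esub> h = inverse h"
      by (intro C.comm_inv_char) (auto simp: ring_of_type_algebra_def)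
    then show ?case using m_inv by (simp add: quartic_field_inverse)
  next
    case (eng_add h1 h2)
    then show ?case by (simp add: ring_of_type_algebra_def quartic_field_arith)
  next
    case (eng_mult h1 h2)
    then show ?case by (simp add: ring_of_type_algebra_def quartic_field_arith)
  qed
next
  fix x assume "x \<in> quartic_field"
  then obtain a b c d where abcd: "a \<in> gauss_rat" "b \<in> gauss_rat" "c \<in> gauss_rat" "d \<in> gauss_rat"
    and x: "x = cubic a b c d \<Theta>" by (elim quartic_fieldE)
  let ?K = "rat_adjoin {\<i>, \<Theta>}"
  have add: "u + v \<in> ?K" and mult: "u * v \<in> ?K" if "u \<in> ?K" "v \<in> ?K" for u v
    using that generate_field.eng_add[of u complex_field _ v] generate_field.eng_mult[of u complex_field _ v]
    by (auto simp: rat_adjoin_def ring_of_type_algebra_def)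
  have incl: "u \<in> ?K" if "u \<in> \<rat> \<union> {\<i>, \<Theta>}" for u
    using that unfolding rat_adjoin_def by (rule generate_field.incl)
  have "u \<in> ?K" if "u \<in> gauss_rat" for u
  proof -
    from that have "of_real (Re u) \<in> (\<rat> :: complex set)" "of_real (Im u) \<in> (\<rat> :: complex set)"
      by (auto simp: gauss_rat_def elim!: Rats_cases')
    then have "of_real (Re u) + \<i> * of_real (Im u) \<in> ?K" by (intro add mult incl) auto
    then show ?thesis by (simp flip: complex_eq)
  qed
  moreover have "\<Theta> \<in> ?K" by (rule incl) simp
  ultimately show "x \<in> ?K"
    unfolding x cubic_def power2_eq_square power3_eq_cube using abcd by (intro add mult)
qed

end

section \<open>Integral elements\<close>

text \<open>Reduction by \<open>z ^ 4 = n\<close> gives coefficients that do not depend on the root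
  \<open>z\<close>. Polynomial relations at one root thus pass to its conjugates without
  constructing automorphisms.\<close>

lemma poly_cubic:
  fixes p :: "int poly"
  assumes "a \<in> gauss_rat" "b \<in> gauss_rat" "c \<in> gauss_rat" "d \<in> gauss_rat"
  obtains a' b' c' d' where "a' \<in> gauss_rat" "b' \<in> gauss_rat" "c' \<in> gauss_rat" "d' \<in> gauss_rat"
    "\<And>z. z ^ 4 = of_nat n \<Longrightarrow> poly (map_poly of_int p) (cubic a b c d z) = cubic a' b' c' d' z"
proof -
  have "\<exists>a'\<in>gauss_rat. \<exists>b'\<in>gauss_rat. \<exists>c'\<in>gauss_rat. \<exists>d'\<in>gauss_rat.
    \<forall>z. z ^ 4 = of_nat n \<longrightarrow> poly (map_poly of_int p) (cubic a b c d z) = cubic a' b' c' d' z"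
  proof (induction p)
    case 0
    show ?case by (intro bexI[of _ 0]) (auto simp: cubic_def)
  next
    case (pCons k p)
    then obtain a' b' c' d' where p: "a' \<in> gauss_rat" "b' \<in> gauss_rat" "c' \<in> gauss_rat" "d' \<in> gauss_rat"
      "\<And>z. z ^ 4 = of_nat n \<Longrightarrow> poly (map_poly of_int p) (cubic a b c d z) = cubic a' b' c' d' z"
      by blast
    have eq: "poly (map_poly of_int (pCons k p)) (cubic a b c d z) =
        cubic (of_int k + (a * a' + of_nat n * (b * d' + c * c' + d * b')))
          (a * b' + b * a' + of_nat n * (c * d' + d * c'))
          (a * c' + b * b' + c * a' + of_nat n * d * d') (a * d' + b * c' + c * b' + d * a') z"
      if "z ^ 4 = of_nat n" for z
    proof -
      have "poly (map_poly of_int (pCons k p)) (cubic a b c d z) =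
          of_int k + cubic a b c d z * cubic a' b' c' d' z"
        using p(5)[OF that] by (simp add: map_poly_pCons)
      then show ?thesis unfolding cubic_mult[OF that] by (simp add: cubic_def)
    qed
    show ?case
      by (intro bexI exI, intro allI impI, erule eq)
        (intro gauss_rat_arith gauss_rat_const assms p)+
  qed
  then show thesis using that by blast
qed

lemma poly_of_int_cnj: "poly (map_poly of_int p) (cnj x) = cnj (poly (map_poly of_int p) x)"
  for p :: "int poly"
  by (induction p) (simp_all add: map_poly_pCons)

text \<open>
  Algebraic integers always form a ring. This is not in the library, but it comes for free in a
  proof by contradiction, where the ring of integers is assumed to be \<open>int_adjoin \<alpha>\<close>.
\<close>

locale quartic_integers = quartic +
  assumes ZK_add: "x \<in> ring_of_integers quartic_field \<Longrightarrow> y \<in> ring_of_integers quartic_field \<Longrightarrow>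
      x + y \<in> ring_of_integers quartic_field"
    and ZK_mult: "x \<in> ring_of_integers quartic_field \<Longrightarrow> y \<in> ring_of_integers quartic_field \<Longrightarrow>
      x * y \<in> ring_of_integers quartic_field"
begin

abbreviation ZK :: "complex set" where "ZK \<equiv> ring_of_integers quartic_field"

lemma of_int_in_ZK: "of_int k \<in> ZK"
  by (auto simp: ring_of_integers_def intro: gauss_rat_in_quartic_field int_imp_algebraic_int)

lemma ii_in_ZK: "\<i> \<in> ZK"
  by (auto simp: ring_of_integers_def intro: gauss_rat_in_quartic_field)

lemma ZK_minus: "x \<in> ZK \<Longrightarrow> - x \<in> ZK"
  by (auto simp: ring_of_integers_def intro: quartic_field_minus)

lemma ZK_diff: "x \<in> ZK \<Longrightarrow> y \<in> ZK \<Longrightarrow> x - y \<in> ZK"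
  using ZK_add[of x "- y"] ZK_minus by simp

lemma ZK_power: "x \<in> ZK \<Longrightarrow> x ^ n \<in> ZK"
  using of_int_in_ZK[of 1] by (induction n) (auto intro: ZK_mult)

lemma ZK_cnj: "x \<in> ZK \<Longrightarrow> cnj x \<in> ZK"
  by (auto simp: ring_of_integers_def intro: quartic_field_cnj)

lemma gauss_int_in_ZK: "x \<in> gauss_int \<Longrightarrow> x \<in> ZK"
  by (auto simp: gauss_int_iff intro!: ZK_add ZK_mult ii_in_ZK of_int_in_ZK)

lemma Theta_in_ZK: "\<Theta> \<in> ZK"
proof -
  have "\<Theta> \<in> quartic_field" using quartic_fieldI[of 0 1 0 0] by (simp add: cubic_def)
  moreover have "algebraic_int \<Theta>"
  proof (rule algebraic_int_root)
    show "poly (monom 1 4) \<Theta> = of_nat m" using Theta_4 by (simp add: poly_monom)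
    show "lead_coeff (monom (1 :: complex) 4) = 1" by (simp add: degree_monom_eq)
    show "\<forall>i. coeff (monom (1 :: complex) 4) i \<in> \<int>" by (simp add: coeff_monom)
    show "degree (monom (1 :: complex) 4) > 0" by (simp add: degree_monom_eq)
  qed (simp add: int_imp_algebraic_int)
  ultimately show ?thesis by (simp add: ring_of_integers_def)
qed

lemma ZK_rat: "x \<in> ZK \<Longrightarrow> x \<in> \<rat> \<Longrightarrow> x \<in> \<int>"
  by (auto simp: ring_of_integers_def intro: rational_algebraic_int_is_int)

text \<open>The integers of Q(i) are Z[i]: the doubled real and imaginary parts \<open>p\<close>,
  \<open>q\<close> are integers, and the norm gives \<open>p\<^sup>2 + q\<^sup>2 = 4 * k\<close>, so
  both are even.\<close>

lemma ZK_gauss_rat: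
  assumes "x \<in> ZK" "x \<in> gauss_rat"
  shows "x \<in> gauss_int"
proof -
  have rat: "of_real (Re x) \<in> (\<rat> :: complex set)" "of_real (Im x) \<in> (\<rat> :: complex set)"
    using assms(2) by (auto simp: gauss_rat_def elim!: Rats_cases')
  have "x + cnj x \<in> ZK" "\<i> * (cnj x - x) \<in> ZK"
    by (intro ZK_add ZK_mult ZK_diff ZK_cnj ii_in_ZK assms)+
  moreover have "x + cnj x = 2 * of_real (Re x)" "\<i> * (cnj x - x) = 2 * of_real (Im x)"
    by (simp_all add: complex_eq_iff)
  ultimately have "2 * complex_of_real (Re x) \<in> \<int>" "2 * complex_of_real (Im x) \<in> \<int>"
    using rat by (auto intro!: ZK_rat)
  then obtain p q where pq: "2 * complex_of_real (Re x) = of_int p" "2 * complex_of_real (Im x) = of_int q"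
    by (auto elim!: Ints_cases)
  have "x * cnj x \<in> ZK" by (intro ZK_mult ZK_cnj assms)
  moreover have "x * cnj x = of_real (Re x) ^ 2 + of_real (Im x) ^ 2"
    by (simp add: complex_eq_iff power2_eq_square)
  ultimately have "of_real (Re x) ^ 2 + of_real (Im x) ^ 2 \<in> (\<int> :: complex set)"
    using rat by (auto intro!: ZK_rat)
  then obtain k where k: "of_real (Re x) ^ 2 + of_real (Im x) ^ 2 = complex_of_int k" by (auto elim!: Ints_cases)
  have "complex_of_int (p\<^sup>2 + q\<^sup>2) = of_int (4 * k)"
    by (simp flip: pq k)
  then have sum: "p\<^sup>2 + q\<^sup>2 = 4 * k" by (simp only: of_int_eq_iff)
  then have "even (p\<^sup>2 + q\<^sup>2)" by simp
  then have "even (p - q)" by simp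
  then obtain j where "p - q = 2 * j" ..
  then have j: "p = q + 2 * j" by simp
  have "2 * q\<^sup>2 = 4 * (k - q * j - j\<^sup>2)" using sum unfolding j by (simp add: power2_eq_square algebra_simps)
  then have "q\<^sup>2 = 2 * (k - q * j - j\<^sup>2)" by linarith
  then have "even (q\<^sup>2)" by simp
  then obtain q' where q': "q = 2 * q'" by auto
  have p': "p = 2 * (q' + j)" using j q' by simp
  have "Re x = of_int (q' + j)" "Im x = of_int q'"
    using arg_cong[OF pq(1), of Re] arg_cong[OF pq(2), of Re] unfolding p' q' by simp_all
  then show ?thesis by (simp add: gauss_int_def)
qed

section \<open>Coordinates of integral elements and their denominators\<close>

definition integral_coords :: "complex \<Rightarrow> complex \<Rightarrow> complex \<Rightarrow> complex \<Rightarrow> bool" where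
  "integral_coords a b c d \<longleftrightarrow> a \<in> gauss_rat \<and> b \<in> gauss_rat \<and> c \<in> gauss_rat \<and> d \<in> gauss_rat \<and>
     (\<forall>z\<in>roots. cubic a b c d z \<in> ZK)"

text \<open>An integer polynomial vanishing at one conjugate vanishes at all four, since its reduced
  coefficients are zero by independence.\<close>

lemma integral_coordsI:
  assumes "a \<in> gauss_rat" "b \<in> gauss_rat" "c \<in> gauss_rat" "d \<in> gauss_rat" "cubic a b c d \<Theta> \<in> ZK"
  shows "integral_coords a b c d"
proof -
  have "algebraic_int (cubic a b c d \<Theta>)" using assms(5) by (simp add: ring_of_integers_def)
  then obtain p :: "int poly" where p: "lead_coeff p = 1" "poly (map_poly of_int p) (cubic a b c d \<Theta>) = 0"
    by (auto simp: algebraic_int_altdef_ipoly)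
  obtain a' b' c' d' where coords: "a' \<in> gauss_rat" "b' \<in> gauss_rat" "c' \<in> gauss_rat" "d' \<in> gauss_rat"
    "\<And>z. z ^ 4 = of_nat m \<Longrightarrow> poly (map_poly of_int p) (cubic a b c d z) = cubic a' b' c' d' z"
    using poly_cubic[OF assms(1-4)] by metis
  have "cubic a' b' c' d' \<Theta> = 0" using coords(5)[OF Theta_4] p by simp
  then have "a' = 0 \<and> b' = 0 \<and> c' = 0 \<and> d' = 0" by (rule gauss_cubic_indep[OF coords(1-4)])
  then have "poly (map_poly of_int p) (cubic a b c d z) = 0" if "z \<in> roots" for z
    using coords(5)[OF roots_power_4[OF that]] by (simp add: cubic_def)
  then have "algebraic_int (cubic a b c d z)" if "z \<in> roots" for z
    using p that by (auto simp: algebraic_int_altdef_ipoly)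
  then show ?thesis
    using assms cubic_roots_in_quartic_field by (auto simp: integral_coords_def ring_of_integers_def)
qed

lemma integral_coords_gauss_int:
  assumes "a \<in> gauss_int" "b \<in> gauss_int" "c \<in> gauss_int" "d \<in> gauss_int"
  shows "integral_coords a b c d"
proof (rule integral_coordsI)
  show "cubic a b c d \<Theta> \<in> ZK"
    unfolding cubic_def by (intro ZK_add ZK_mult ZK_power gauss_int_in_ZK Theta_in_ZK assms)
qed (use assms in \<open>auto simp: gauss_int_def gauss_rat_def elim!: Ints_cases\<close>)

text \<open>The products over the roots with square \<open>\<Theta>\<^sup>2\<close> and over those
  with square \<open>- \<Theta>\<^sup>2\<close> are integral; the two expressions are their sum and
  product.\<close>

lemma integral_coords_norms:
  assumes "integral_coords a b c d"
  shows "2 * norm_fst (of_nat m) a b c d \<in> ZK"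
    "norm_fst (of_nat m) a b c d ^ 2 - of_nat m * norm_snd (of_nat m) a b c d ^ 2 \<in> ZK"
proof -
  let ?P = "cubic a b c d \<Theta> * cubic a b c d (- \<Theta>)"
  let ?Q = "cubic a b c d (\<i> * \<Theta>) * cubic a b c d (- (\<i> * \<Theta>))"
  have ZK: "?P \<in> ZK" "?Q \<in> ZK" using assms by (auto simp: integral_coords_def roots_def intro!: ZK_mult)
  have "?P = norm_fst (of_nat m) a b c d + \<Theta>\<^sup>2 * norm_snd (of_nat m) a b c d"
    by (rule cubic_times_cubic_minus[OF Theta_4])
  moreover have "?Q = norm_fst (of_nat m) a b c d + (\<i> * \<Theta>)\<^sup>2 * norm_snd (of_nat m) a b c d"
    by (rule cubic_times_cubic_minus) (simp add: power_mult_distrib Theta_4)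
  ultimately have "2 * norm_fst (of_nat m) a b c d = ?P + ?Q" by (simp add: power_mult_distrib)
  then show "2 * norm_fst (of_nat m) a b c d \<in> ZK" using ZK by (simp add: ZK_add)
  have "norm_fst (of_nat m) a b c d ^ 2 - of_nat m * norm_snd (of_nat m) a b c d ^ 2 = ?P * ?Q"
    by (rule cubic_norm[OF Theta_4, symmetric])
  then show "norm_fst (of_nat m) a b c d ^ 2 - of_nat m * norm_snd (of_nat m) a b c d ^ 2 \<in> ZK"
    using ZK by (simp add: ZK_mult)
qed

text \<open>Weighting the conjugates by \<open>z ^ k\<close> and summing isolates one coordinate,
  since power sums of the four roots vanish unless 4 divides the exponent. The factor
  \<open>m\<close> is \<open>\<Theta> ^ 4\<close>.\<close>

lemma integral_coords_traces:
  assumes "integral_coords a b c d"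
  shows "4 * of_nat m * a \<in> ZK" "4 * of_nat m * b \<in> ZK" "4 * of_nat m * c \<in> ZK" "4 * of_nat m * d \<in> ZK"
proof -
  define S where "S k = (\<Sum>z\<leftarrow>[\<Theta>, - \<Theta>, \<i> * \<Theta>, - (\<i> * \<Theta>)]. z ^ k * cubic a b c d z)" for k
  have "S k \<in> ZK" for k
    using assms unfolding S_def
    by (auto simp: integral_coords_def roots_def intro!: ZK_add ZK_mult ZK_power ZK_minus ii_in_ZK Theta_in_ZK)
  moreover have "S 0 = 4 * a" "S 1 = 4 * of_nat m * d" "S 2 = 4 * of_nat m * c" "S 3 = 4 * of_nat m * b"
    unfolding S_def cubic_def Theta_4[symmetric]
    by (simp_all add: power2_eq_square power3_eq_cube power4_eq_xxxx algebra_simps)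
  moreover have "of_nat m \<in> ZK" using of_int_in_ZK[of "int m"] by simp
  ultimately show "4 * of_nat m * a \<in> ZK" "4 * of_nat m * b \<in> ZK" "4 * of_nat m * c \<in> ZK" "4 * of_nat m * d \<in> ZK"
    using ZK_mult[of "of_nat m" "4 * a"] by (metis mult.left_commute mult.assoc)+
qed

text \<open>
  The primes dividing the common denominator \<open>n\<close> are removed one at a time; the traces bound
  \<open>n\<close> by \<open>4 m\<close>, so that only primes dividing \<open>2 m\<close> occur.
\<close>

lemma integral_coords_rat_descent:
  assumes "n dvd 4 * m" "integral_coords a b c d"
    and "a \<in> \<rat>" "b \<in> \<rat>" "c \<in> \<rat>" "d \<in> \<rat>"
    and "of_nat n * a \<in> \<int>" "of_nat n * b \<in> \<int>" "of_nat n * c \<in> \<int>" "of_nat n * d \<in> \<int>"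
  shows "a \<in> \<int> \<and> b \<in> \<int> \<and> c \<in> \<int> \<and> d \<in> \<int>"
  using assms
proof (induction n rule: less_induct)
  case (less n)
  have n0: "n \<noteq> 0"
  proof
    assume "n = 0"
    with less.prems(1) m_gt_1 show False by simp
  qed
  show ?case
  proof (cases "n = 1")
    case True
    then show ?thesis using less.prems by simp
  next
    case False
    then obtain p where p: "Factorial_Ring.prime p" "p dvd n" using prime_factor_nat by blast
    then obtain n' where n': "n = p * n'" by auto
    have "n' < n" using p n' n0 prime_gt_1_nat[OF p(1)] by auto
    have "n' dvd 4 * m" using less.prems(1) n' by (metis dvd_mult_right)
    \<comment> \<open>Multiplication by \<open>n'\<close> leaves at most the denominator
      \<open>p\<close> and keeps the element integral.\<close>
    define A B C D where defs: "A = of_nat n' * a" "B = of_nat n' * b" "C = of_nat n' * c" "D = of_nat n' * d"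
    have rat: "A \<in> \<rat>" "B \<in> \<rat>" "C \<in> \<rat>" "D \<in> \<rat>" using less.prems by (auto simp: defs)
    have "of_nat p * A \<in> \<int>" "of_nat p * B \<in> \<int>" "of_nat p * C \<in> \<int>" "of_nat p * D \<in> \<int>"
      using less.prems by (simp_all add: defs n' mult.assoc)
    then obtain a' b' c' d' where ints: "of_nat p * A = of_int a'" "of_nat p * B = of_int b'"
      "of_nat p * C = of_int c'" "of_nat p * D = of_int d'"
      by (auto elim!: Ints_cases)
    have ic: "integral_coords A B C D"
      using less.prems(2) of_int_in_ZK[of "int n'"]
      by (auto simp: integral_coords_def defs simp flip: cubic_scale intro!: ZK_mult)
    let ?F = "norm_fst (of_nat m) A B C D" and ?S = "norm_snd (of_nat m) A B C D"
    have FS_rat: "?F \<in> \<rat>" "?S \<in> \<rat>" using rat by (auto simp: norm_fst_def norm_snd_def)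
    \<comment> \<open>Trace and norm over Q make the norm parts integers; passing to
      \<open>a'\<close>, ..., \<open>d'\<close> multiplies both by \<open>p ^ 2\<close>.\<close>
    have "?F \<in> \<int> \<and> ?S \<in> \<int>"
      using integral_coords_norms[OF ic] FS_rat squarefree_m m_mod_4
      by (intro squarefree_half_integral[of _ _ m] ZK_rat) auto
    then obtain f s where fs: "?F = of_int f" "?S = of_int s" by (auto elim!: Ints_cases)
    have "(of_int (norm_fst (int m) a' b' c' d') :: complex) = of_int (int p ^ 2 * f)"
      by (simp add: norm_fst_def flip: ints fs) (simp add: norm_fst_def power2_eq_square algebra_simps)
    then have "int p ^ 2 dvd norm_fst (int m) a' b' c' d'" by (simp only: of_int_eq_iff) simp
    moreover have "(of_int (norm_snd (int m) a' b' c' d') :: complex) = of_int (int p ^ 2 * s)"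
      by (simp add: norm_snd_def flip: ints fs) (simp add: norm_snd_def power2_eq_square algebra_simps)
    then have "int p ^ 2 dvd norm_snd (int m) a' b' c' d'" by (simp only: of_int_eq_iff) simp
    moreover have "p dvd 2 * m"
    proof -
      have "p dvd 2 * (2 * m)" using dvd_trans[OF p(2) less.prems(1)] by simp
      then have "p dvd 2 \<or> p dvd 2 * m" by (rule prime_dvd_multD[OF p(1)])
      then show ?thesis by auto
    qed
    ultimately have "int p dvd a' \<and> int p dvd b' \<and> int p dvd c' \<and> int p dvd d'"
      using prime_dvd_coeffs_if_square_dvd_norms p(1) squarefree_m m_mod_4 by blast
    moreover have "x \<in> \<int>" if "of_nat p * x = of_int k" "int p dvd k" for x :: complex and k
      using that p(1) by (auto elim!: dvdE simp: prime_gt_0_nat)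
    ultimately have "A \<in> \<int>" "B \<in> \<int>" "C \<in> \<int>" "D \<in> \<int>" using ints by blast+
    then show ?thesis
      using less.IH[OF \<open>n' < n\<close> \<open>n' dvd 4 * m\<close> less.prems(2-6)] by (simp add: defs)
  qed
qed

lemma integral_coords_rat:
  assumes "integral_coords a b c d" "a \<in> \<rat>" "b \<in> \<rat>" "c \<in> \<rat>" "d \<in> \<rat>"
  shows "a \<in> \<int>" "b \<in> \<int>" "c \<in> \<int>" "d \<in> \<int>"
proof -
  have "of_nat (4 * m) * a \<in> \<int>" "of_nat (4 * m) * b \<in> \<int>" "of_nat (4 * m) * c \<in> \<int>" "of_nat (4 * m) * d \<in> \<int>"
    using integral_coords_traces[OF assms(1)] assms(2-5) by (auto intro!: ZK_rat)
  then have "a \<in> \<int> \<and> b \<in> \<int> \<and> c \<in> \<int> \<and> d \<in> \<int>"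
    using integral_coords_rat_descent[OF dvd_refl] assms by blast
  then show "a \<in> \<int>" "b \<in> \<int>" "c \<in> \<int>" "d \<in> \<int>" by auto
qed

text \<open>Complex conjugation fixes \<theta>, so applying \<open>x + cnj x\<close> and
  \<open>\<i> * (cnj x - x)\<close> to the coordinates keeps integrality and makes them rational,
  hence integers. Together they recover \<open>2 * x\<close>.\<close>

lemma integral_coords_half:
  assumes "integral_coords a b c d"
  shows "2 * a \<in> gauss_int" "2 * b \<in> gauss_int" "2 * c \<in> gauss_int" "2 * d \<in> gauss_int"
proof -
  have gr: "a \<in> gauss_rat" "b \<in> gauss_rat" "c \<in> gauss_rat" "d \<in> gauss_rat"
    and ZK: "\<And>z. z \<in> roots \<Longrightarrow> cubic a b c d z \<in> ZK"
    using assms by (auto simp: integral_coords_def)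
  have cnj_roots: "cnj z \<in> roots" if "z \<in> roots" for z
    using that by (auto simp: roots_def)
  have conj: "cubic (cnj a) (cnj b) (cnj c) (cnj d) z \<in> ZK" if "z \<in> roots" for z
    using ZK_cnj[OF ZK[OF cnj_roots[OF that]]] by (simp add: cnj_cubic)
  have "integral_coords (a + cnj a) (b + cnj b) (c + cnj c) (d + cnj d)"
    using ZK conj gr unfolding integral_coords_def by (auto simp flip: cubic_add intro!: ZK_add)
  moreover have "integral_coords (\<i> * (cnj a - a)) (\<i> * (cnj b - b)) (\<i> * (cnj c - c)) (\<i> * (cnj d - d))"
    using ZK conj gr unfolding integral_coords_def
    by (auto simp flip: cubic_diff cubic_scale intro!: ZK_diff ZK_mult ii_in_ZK)
  moreover have "x + cnj x \<in> \<rat>" "\<i> * (cnj x - x) \<in> \<rat>" if "x \<in> gauss_rat" for x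
  proof -
    have "of_real (Re x) \<in> (\<rat> :: complex set)" "of_real (Im x) \<in> (\<rat> :: complex set)"
      using that by (auto simp: gauss_rat_def elim!: Rats_cases')
    moreover have "x + cnj x = 2 * of_real (Re x)" "\<i> * (cnj x - x) = 2 * of_real (Im x)"
      by (simp_all add: complex_eq_iff)
    ultimately show "x + cnj x \<in> \<rat>" "\<i> * (cnj x - x) \<in> \<rat>" by auto
  qed
  moreover have "2 * x \<in> gauss_int" if re: "x + cnj x \<in> \<int>" and im: "\<i> * (cnj x - x) \<in> \<int>" for x
  proof -
    obtain k where "x + cnj x = of_int k" using re by (elim Ints_cases)
    moreover obtain l where "\<i> * (cnj x - x) = of_int l" using im by (elim Ints_cases)
    ultimately have "2 * x = of_int k + \<i> * of_int l" by (simp add: complex_eq_iff)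
    then show ?thesis by (auto simp: gauss_int_iff)
  qed
  ultimately show "2 * a \<in> gauss_int" "2 * b \<in> gauss_int" "2 * c \<in> gauss_int" "2 * d \<in> gauss_int"
    using integral_coords_rat gr by meson+
qed

lemma integral_coords_diff_scale:
  assumes "integral_coords a b c d" "integral_coords a' b' c' d'" "k \<in> gauss_int"
  shows "integral_coords (a - k * a') (b - k * b') (c - k * c') (d - k * d')"
proof -
  have "k \<in> gauss_rat" using assms(3) by (auto simp: gauss_int_def gauss_rat_def elim!: Ints_cases)
  moreover have "k \<in> ZK" using assms(3) by (rule gauss_int_in_ZK)
  ultimately show ?thesis
    using assms(1,2) unfolding integral_coords_def
    by (auto simp flip: cubic_diff cubic_scale intro!: ZK_diff ZK_mult)
qed

section \<open>Further integral elements and the parity conditions\<close>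

lemma ZK_if_poly_in_ZK:
  assumes "x \<in> quartic_field" "poly p x \<in> ZK" "lead_coeff p = 1" "\<forall>i. coeff p i \<in> \<int>" "degree p > 0"
  shows "x \<in> ZK"
  using assms algebraic_int_root[of "poly p x" p x] by (auto simp: ring_of_integers_def)

lemma odd_integral_coords:
  assumes m: "m mod 4 = 3" and ic: "integral_coords a b c d"
    and coords: "2 * a = of_int x0 + \<i> * of_int y0" "2 * b = of_int x1 + \<i> * of_int y1"
      "2 * c = of_int x2 + \<i> * of_int y2" "2 * d = of_int x3 + \<i> * of_int y3"
  shows "even (y0 + x2)" "even (x1 - y3)" "even (y1 + x3)"
proof -
  \<comment> \<open>This is (1 + sqrt(-m)) / 2 with sqrt(-m) = \<i> \<theta>^2, integral because -m
    is 1 modulo 4.\<close>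
  define \<omega> where "\<omega> = cubic (1 / 2) 0 (\<i> / 2) 0 \<Theta>"
  have "\<omega> \<in> quartic_field" unfolding \<omega>_def by (rule quartic_fieldI) auto
  moreover have "poly [:0, -1, 1:] \<omega> \<in> ZK"
  proof -
    define j where "j = m div 4 + 1"
    have j: "m + 1 = 4 * j" using m unfolding j_def by presburger
    have "poly [:0, -1, 1:] \<omega> = - ((\<Theta> ^ 4 + 1) / 4)"
      by (simp add: \<omega>_def cubic_def power2_eq_square power4_eq_xxxx field_simps)
    also have "\<dots> = - (of_nat (m + 1) / 4)" by (simp add: Theta_4 field_simps)
    also have "\<dots> = of_int (- int j)" by (simp only: j) simp
    finally show ?thesis by (simp only: of_int_in_ZK)
  qed
  ultimately have \<omega>: "\<omega> \<in> ZK"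
    by (rule ZK_if_poly_in_ZK) (auto simp: coeff_pCons split: nat.splits)
  have "cubic 0 (1 / 2) 0 (\<i> / 2) \<Theta> = \<omega> * \<Theta>"
    by (simp add: \<omega>_def cubic_def power2_eq_square power3_eq_cube algebra_simps)
  then have "cubic 0 (1 / 2) 0 (\<i> / 2) \<Theta> \<in> ZK" using \<omega> Theta_in_ZK by (simp add: ZK_mult)
  then have ic1: "integral_coords 0 (1 / 2) 0 (\<i> / 2)" by (intro integral_coordsI) auto
  have ic2: "integral_coords (1 / 2) 0 (\<i> / 2) 0"
    using \<omega> unfolding \<omega>_def by (intro integral_coordsI) auto
  define g where "g = of_int (x0 - y2) + \<i> * of_int (y0 + x2)"
  define h where "h = of_int (x1 - y3) + \<i> * of_int (y1 + x3)"
  txt \<open>Subtracting Gaussian multiples of \<open>\<omega>\<close> and \<open>\<omega> \<theta>\<close> clears the last two coordinates.\<close>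
  have "- \<i> * (2 * c) \<in> gauss_int" "- \<i> * (2 * d) \<in> gauss_int" by (auto simp: coords)
  from integral_coords_diff_scale[OF integral_coords_diff_scale[OF ic ic2 this(1)] ic1 this(2)]
  have "integral_coords (a + \<i> * c) (b + \<i> * d) 0 0" by (simp add: algebra_simps)
  moreover have "2 * (a + \<i> * c) = g" "2 * (b + \<i> * d) = h"
    unfolding distrib_left mult.left_commute[of 2 \<i>] coords g_def h_def by (simp_all add: algebra_simps)
  then have "a + \<i> * c = g / 2" "b + \<i> * d = h / 2" by (simp_all flip: \<open>_ = g\<close> \<open>_ = h\<close>)
  ultimately have ic': "integral_coords (g / 2) (h / 2) 0 0" by simp
  have gh: "g \<in> gauss_rat" "h \<in> gauss_rat" by (auto simp: g_def h_def)
  have eq: "2 * norm_fst (of_nat m) (g / 2) (h / 2) 0 0 = g\<^sup>2 / 2"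
    "norm_fst (of_nat m) (g / 2) (h / 2) 0 0 ^ 2 - of_nat m * norm_snd (of_nat m) (g / 2) (h / 2) 0 0 ^ 2
      = (g ^ 4 - of_nat m * h ^ 4) / 16"
    by (simp_all add: norm_fst_def norm_snd_def power_divide diff_divide_distrib flip: power_mult)
  have "g\<^sup>2 / 2 \<in> ZK" "(g ^ 4 - of_nat m * h ^ 4) / 16 \<in> ZK"
    using integral_coords_norms[OF ic'] unfolding eq by blast+
  then have "g\<^sup>2 / 2 \<in> gauss_int" "(g ^ 4 - of_nat m * h ^ 4) / 16 \<in> gauss_int"
    using gh by (auto intro!: ZK_gauss_rat)
  from odd_lattice_parity[OF m this[unfolded g_def h_def]]
  show "even (y0 + x2)" "even (x1 - y3)" "even (y1 + x3)" by blast+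
qed

text \<open>Integrality climbs a tower: \<eta> has square \<open>- \<i> * n\<close>, and \<epsilon>
  has its square in Z[i] + Z[i] \<eta>, because \<open>1 - \<i> * n\<close> is divisible by
  \<open>1 + \<i>\<close> for odd \<open>n\<close>.\<close>

lemma even_integral_element:
  assumes "m = 2 * n" "odd n"
  shows "integral_coords 0 ((1 - \<i>) / 2) 0 (- \<i> / 2)"
proof (rule integral_coordsI)
  define \<eta> where "\<eta> = (1 - \<i>) / 2 * \<Theta>\<^sup>2"
  define \<epsilon> where "\<epsilon> = cubic 0 ((1 - \<i>) / 2) 0 (- \<i> / 2) \<Theta>"
  obtain j where j: "n = 2 * j + 1" using assms(2) by (elim oddE)
  have Theta_4': "\<Theta> * (\<Theta> * (\<Theta> * \<Theta>)) = 2 * of_nat n"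
    using Theta_4 by (simp add: assms(1) power4_eq_xxxx mult.assoc)
  have \<eta>_sq: "\<eta>\<^sup>2 = - \<i> * of_nat n"
    by (simp add: \<eta>_def power2_eq_square algebra_simps Theta_4')
  have "\<eta> = cubic 0 0 ((1 - \<i>) / 2) 0 \<Theta>" by (simp add: \<eta>_def cubic_def)
  then have "\<eta> \<in> quartic_field" by (simp add: quartic_fieldI)
  moreover have "poly (monom 1 2) \<eta> \<in> ZK"
    using ZK_mult[OF ZK_minus[OF ii_in_ZK] of_int_in_ZK[of "int n"]] by (simp add: poly_monom \<eta>_sq)
  ultimately have \<eta>: "\<eta> \<in> ZK"
    by (rule ZK_if_poly_in_ZK) (simp_all add: degree_monom_eq coeff_monom)
  have "\<epsilon> = (1 - \<i>) / 2 * \<Theta> * (1 + \<eta>)"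
    by (simp add: \<epsilon>_def \<eta>_def cubic_def power2_eq_square power3_eq_cube field_simps)
  moreover have "(1 + \<eta>)\<^sup>2 = 1 + 2 * \<eta> + \<eta>\<^sup>2" by (simp add: power2_sum)
  ultimately have "\<epsilon>\<^sup>2 = ((1 - \<i>) / 2)\<^sup>2 * \<Theta>\<^sup>2 * (1 + 2 * \<eta> + \<eta>\<^sup>2)"
    by (simp only: power_mult_distrib)
  also have "((1 - \<i>) / 2)\<^sup>2 * \<Theta>\<^sup>2 = (1 - \<i>) / 2 * \<eta>"
    by (simp add: \<eta>_def power2_eq_square)
  also have "(1 - \<i>) / 2 * \<eta> * (1 + 2 * \<eta> + \<eta>\<^sup>2) =
      (1 - \<i>) / 2 * (1 + \<eta>\<^sup>2) * \<eta> + (1 - \<i>) * \<eta>\<^sup>2"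
    by (simp add: power2_eq_square field_simps)
  also have "\<dots> = (- of_nat j - \<i> * (of_nat j + 1)) * \<eta> - (1 + \<i>) * of_nat n"
    unfolding \<eta>_sq by (simp add: j field_simps)
  finally have \<epsilon>_sq: "\<epsilon>\<^sup>2 = (- of_nat j - \<i> * (of_nat j + 1)) * \<eta> - (1 + \<i>) * of_nat n" .
  have "\<epsilon> \<in> quartic_field" unfolding \<epsilon>_def by (rule quartic_fieldI) auto
  moreover have "poly (monom 1 2) \<epsilon> \<in> ZK"
    unfolding poly_monom \<epsilon>_sq mult_1_left
    by (intro ZK_diff ZK_mult[OF _ \<eta>] gauss_int_in_ZK) auto
  ultimately show "cubic 0 ((1 - \<i>) / 2) 0 (- \<i> / 2) \<Theta> \<in> ZK"
    unfolding \<epsilon>_def[symmetric]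
    by (rule ZK_if_poly_in_ZK) (simp_all add: degree_monom_eq coeff_monom)
qed auto

lemma even_integral_coords:
  assumes m: "m = 2 * n" "odd n" and ic: "integral_coords a b c d"
    and coords: "2 * a = of_int x0 + \<i> * of_int y0" "2 * b = of_int x1 + \<i> * of_int y1"
      "2 * c = of_int x2 + \<i> * of_int y2" "2 * d = of_int x3 + \<i> * of_int y3"
  shows "even y0" "even (x1 - x3 + y3)" "even (y1 - x3 - y3)"
proof -
  define g where "g = of_int x0 + \<i> * of_int y0"
  define h where "h = of_int (x1 - x3 + y3) + \<i> * of_int (y1 - x3 - y3)"
  define k where "k = of_int x2 + \<i> * of_int y2"
  \<comment> \<open>This multiple of the additional integral element cancels the last
    coordinate.\<close>
  have "\<i> * (2 * d) \<in> gauss_int" by (auto simp: coords)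
  from integral_coords_diff_scale[OF ic even_integral_element[OF m] this]
  have "integral_coords a (b - (1 + \<i>) * d) c 0" by (simp add: algebra_simps)
  moreover have "2 * (b - (1 + \<i>) * d) = h"
    unfolding right_diff_distrib mult.left_commute[of 2] coords h_def by (simp add: algebra_simps)
  then have "b - (1 + \<i>) * d = h / 2" by (simp flip: \<open>_ = h\<close>)
  moreover have "a = g / 2" "c = k / 2" by (simp_all add: g_def k_def flip: coords)
  ultimately have ic': "integral_coords (g / 2) (h / 2) (k / 2) 0" by simp
  have ghk: "g \<in> gauss_rat" "h \<in> gauss_rat" "k \<in> gauss_rat" "k \<in> gauss_int"
    by (auto simp: g_def h_def k_def)
  have eq1: "2 * norm_fst (of_nat m) (g / 2) (h / 2) (k / 2) 0 = (g\<^sup>2 + 2 * of_int (int n) * k\<^sup>2) / 2"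
    by (simp add: norm_fst_def m(1) power2_eq_square field_simps)
  have eq2: "norm_fst (of_nat m) (g / 2) (h / 2) (k / 2) 0 ^ 2
      - of_nat m * norm_snd (of_nat m) (g / 2) (h / 2) (k / 2) 0 ^ 2
      = ((g\<^sup>2 + 2 * of_int (int n) * k\<^sup>2)\<^sup>2 - 2 * of_int (int n) * (2 * g * k - h\<^sup>2)\<^sup>2) / 16"
  proof -
    have "norm_fst (of_nat m) (g / 2) (h / 2) (k / 2) 0 = (g\<^sup>2 + 2 * of_int (int n) * k\<^sup>2) / 4"
      "norm_snd (of_nat m) (g / 2) (h / 2) (k / 2) 0 = (2 * g * k - h\<^sup>2) / 4"
      by (simp_all add: norm_fst_def norm_snd_def m(1) power2_eq_square field_simps)
    then show ?thesis by (simp only: power_divide m(1)) (simp add: diff_divide_distrib)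
  qed
  have "(g\<^sup>2 + 2 * of_int (int n) * k\<^sup>2) / 2 \<in> ZK"
    "((g\<^sup>2 + 2 * of_int (int n) * k\<^sup>2)\<^sup>2 - 2 * of_int (int n) * (2 * g * k - h\<^sup>2)\<^sup>2) / 16 \<in> ZK"
    using integral_coords_norms[OF ic'] unfolding eq1 eq2 by blast+
  moreover have "(g\<^sup>2 + 2 * of_int (int n) * k\<^sup>2) / 2 \<in> gauss_rat"
    "((g\<^sup>2 + 2 * of_int (int n) * k\<^sup>2)\<^sup>2 - 2 * of_int (int n) * (2 * g * k - h\<^sup>2)\<^sup>2) / 16 \<in> gauss_rat"
    using ghk(1-3) by auto
  ultimately have "(g\<^sup>2 + 2 * of_int (int n) * k\<^sup>2) / 2 \<in> gauss_int"
    "((g\<^sup>2 + 2 * of_int (int n) * k\<^sup>2)\<^sup>2 - 2 * of_int (int n) * (2 * g * k - h\<^sup>2)\<^sup>2) / 16 \<in> gauss_int"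
    by (auto intro: ZK_gauss_rat)
  moreover have "odd (int n)" using m(2) by simp
  ultimately show "even y0" "even (x1 - x3 + y3)" "even (y1 - x3 - y3)"
    using even_lattice_parity[OF _ ghk(4), of "int n" x0 y0 "x1 - x3 + y3" "y1 - x3 - y3"]
    unfolding g_def h_def by blast+
qed

end

section \<open>Differences of conjugates of a generator\<close>

text \<open>
  The norm over \<open>\<rat>(\<i>)\<close> of \<open>x - \<sigma> x\<close> for \<open>x = cubic a b c d \<theta>\<close>, where \<open>\<sigma>\<close> sends \<open>\<i>\<close> to \<open>- \<i>\<close>
  and \<open>\<theta>\<close> to \<open>- e \<i> \<theta>\<close>.
\<close>

definition twist_norm :: "nat \<Rightarrow> int \<Rightarrow> complex \<Rightarrow> complex \<Rightarrow> complex \<Rightarrow> complex \<Rightarrow> complex" where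
  "twist_norm m e a b c d =
    norm_fst (of_nat m) (a - cnj a) (b + of_int e * \<i> * cnj b) (c + cnj c) (d - of_int e * \<i> * cnj d) ^ 2
    - of_nat m * norm_snd (of_nat m) (a - cnj a) (b + of_int e * \<i> * cnj b) (c + cnj c) (d - of_int e * \<i> * cnj d) ^ 2"

lemma twist_norm_formula:
  assumes e: "e = 1 \<or> e = - 1"
    and coords: "2 * a = of_int x0 + \<i> * of_int y0" "2 * b = of_int x1 + \<i> * of_int y1"
      "2 * c = of_int x2 + \<i> * of_int y2" "2 * d = of_int x3 + \<i> * of_int y3"
  shows "4 * twist_norm m e a b c d = of_int (4 * (y0\<^sup>2 - int m * (e * x2)\<^sup>2 + int m * (x1 + e * y1) * (x3 - e * y3))\<^sup>2
    + int m * (4 * y0 * (e * x2) - (x1 + e * y1)\<^sup>2 + int m * (x3 - e * y3)\<^sup>2)\<^sup>2)"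
proof -
  define s q where "s = x1 + e * y1" and "q = x3 - e * y3"
  define A where "A = y0\<^sup>2 - int m * (e * x2)\<^sup>2 + int m * s * q"
  define B where "B = 4 * y0 * (e * x2) - s\<^sup>2 + int m * q\<^sup>2"
  have halves: "a = (of_int x0 + \<i> * of_int y0) / 2" "b = (of_int x1 + \<i> * of_int y1) / 2"
      "c = (of_int x2 + \<i> * of_int y2) / 2" "d = (of_int x3 + \<i> * of_int y3) / 2"
    by (simp_all flip: coords)
  have e2: "e * e = 1" using e by auto
  \<comment> \<open>The factors \<open>1 + e * \<i>\<close> and \<open>1 - e * \<i>\<close> have
    product 2 and imaginary squares. So the first norm part is real and the second imaginary, and
    the minus sign in the norm turns into a plus.\<close>
  have D: "a - cnj a = \<i> * of_int y0" "b + of_int e * \<i> * cnj b = of_int s / 2 * (1 + of_int e * \<i>)"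
    "c + cnj c = of_int x2" "d - of_int e * \<i> * cnj d = of_int q / 2 * (1 - of_int e * \<i>)"
    unfolding halves s_def q_def using e by (auto simp: field_simps)
  have fst: "norm_fst (of_nat m) (a - cnj a) (b + of_int e * \<i> * cnj b) (c + cnj c) (d - of_int e * \<i> * cnj d)
     = - of_int A"
    unfolding D norm_fst_def A_def using e by (auto simp: power2_eq_square field_simps)
  have snd: "2 * norm_snd (of_nat m) (a - cnj a) (b + of_int e * \<i> * cnj b) (c + cnj c) (d - of_int e * \<i> * cnj d)
     = of_int e * \<i> * of_int B"
    unfolding D norm_snd_def B_def using e by (auto simp: power2_eq_square field_simps)
  have "4 * twist_norm m e a b c d = 4 * (- of_int A)\<^sup>2 - of_nat m * (of_int e * \<i> * of_int B)\<^sup>2"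
    unfolding twist_norm_def fst snd[symmetric] by (simp add: power_mult_distrib algebra_simps)
  also have "\<dots> = of_int (4 * A\<^sup>2 + int m * B\<^sup>2)"
    using e by (auto simp: power_mult_distrib)
  finally show ?thesis unfolding A_def B_def s_def q_def .
qed

lemma dvd_4_if_dvd_16_and_4_times:
  fixes N :: int
  assumes "m mod 4 = 3" "N dvd 16" "N dvd 4 * m"
  shows "N dvd 4"
proof -
  have "4 = 16 * (m div 4 + 1) - 4 * m" using assms(1) by presburger
  with assms(2,3) show ?thesis by (metis dvd_diff dvd_mult2)
qed

lemma dvd_2_if_dvd_16_and_2_times_odd:
  fixes N w :: int
  assumes "odd w" "N dvd 16" "N dvd 2 * w"
  shows "N dvd 2"
proof -
  obtain j where j: "w = 2 * j + 1" using assms(1) by (elim oddE)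
  \<comment> \<open>Odd squares are 1 modulo 8, hence \<open>2 * w * w\<close> is 2 modulo
    16.\<close>
  have "even (j * (j + 1))" by simp
  then obtain k where "j * (j + 1) = 2 * k" ..
  then have "2 = 2 * w * w - 16 * k" by (simp add: j algebra_simps)
  with assms(2,3) show ?thesis by (metis dvd_diff dvd_mult2)
qed

text \<open>For \<open>u = \<alpha>\<close> and \<open>v\<close> a conjugate of it, this is the
  divisibility of differences on which the proof rests. The set \<open>R\<close> collects the
  closure properties that keep the quotient integral.\<close>

lemma poly_diff_factor:
  fixes p :: "int poly"
  assumes add: "\<And>x y. x \<in> R \<Longrightarrow> y \<in> R \<Longrightarrow> x + y \<in> R" and mult: "\<And>x y. x \<in> R \<Longrightarrow> y \<in> R \<Longrightarrow> x * y \<in> R"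
    and ints: "\<And>k. of_int k \<in> R" and "u \<in> R" "v \<in> R"
  shows "\<exists>q\<in>R. poly (map_poly of_int p) u - poly (map_poly of_int p) v = (u - v) * (q :: complex)"
proof (induction p)
  case 0
  show ?case using ints[of 0] by (intro bexI[of _ 0]) auto
next
  case (pCons k p)
  have eval: "poly (map_poly of_int r) u \<in> R" for r :: "int poly"
  proof (induction r)
    case 0
    show ?case using ints[of 0] by simp
  next
    case (pCons k r)
    then show ?case using ints assms(4) by (auto simp: map_poly_pCons intro!: add mult)
  qed
  obtain q where q: "q \<in> R" "poly (map_poly of_int p) u - poly (map_poly of_int p) v = (u - v) * q"
    using pCons.IH by blast
  have "poly (map_poly of_int (pCons k p)) u - poly (map_poly of_int (pCons k p)) v
      = (u - v) * poly (map_poly of_int p) u + v * (poly (map_poly of_int p) u - poly (map_poly of_int p) v)"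
    by (simp add: map_poly_pCons algebra_simps)
  also have "\<dots> = (u - v) * (poly (map_poly of_int p) u + v * q)"
    unfolding q(2) by (simp add: algebra_simps)
  finally show ?case
    by (rule bexI[where x = "poly (map_poly of_int p) u + v * q"]) (intro add mult eval q(1) assms(5))
qed

context quartic_integers
begin

lemma twist_norm_eq_prod:
  fixes a b c d :: complex
  assumes "e = 1 \<or> e = - 1"
  defines "\<delta> \<equiv> \<lambda>z. cubic a b c d z - cubic (cnj a) (cnj b) (cnj c) (cnj d) (- of_int e * \<i> * z)"
  shows "twist_norm m e a b c d = \<delta> \<Theta> * \<delta> (- \<Theta>) * (\<delta> (\<i> * \<Theta>) * \<delta> (- (\<i> * \<Theta>)))"
proof -
  have "\<delta> z = cubic (a - cnj a) (b + of_int e * \<i> * cnj b) (c + cnj c) (d - of_int e * \<i> * cnj d) z" for z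
    using assms(1) by (auto simp: \<delta>_def cubic_def power2_eq_square power3_eq_cube algebra_simps)
  then show ?thesis by (simp only: twist_norm_def cubic_norm[OF Theta_4])
qed

text \<open>The second element is a polynomial in the generator, at every root by
  \<open>poly_cubic\<close>. So each of the four differences is a multiple of the one for the
  generator, and the quotients multiply up.\<close>

lemma twist_norm_dvd:
  assumes gen: "ZK = int_adjoin (cubic a b c d \<Theta>)" and ic: "integral_coords a b c d"
    and ic': "integral_coords a' b' c' d'" and e: "e = 1 \<or> e = - 1"
  shows "\<exists>q\<in>ZK. twist_norm m e a' b' c' d' = twist_norm m e a b c d * q"
proof -
  define \<delta> where "\<delta> = (\<lambda>z. cubic a b c d z - cubic (cnj a) (cnj b) (cnj c) (cnj d) (- of_int e * \<i> * z))"
  define \<delta>' where "\<delta>' = (\<lambda>z. cubic a' b' c' d' z - cubic (cnj a') (cnj b') (cnj c') (cnj d') (- of_int e * \<i> * z))"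
  have gr: "a \<in> gauss_rat" "b \<in> gauss_rat" "c \<in> gauss_rat" "d \<in> gauss_rat"
    and gr': "a' \<in> gauss_rat" "b' \<in> gauss_rat" "c' \<in> gauss_rat" "d' \<in> gauss_rat"
    and ZK: "\<And>z. z \<in> roots \<Longrightarrow> cubic a b c d z \<in> ZK" and "cubic a' b' c' d' \<Theta> \<in> ZK"
    using ic ic' by (auto simp: integral_coords_def roots_def)
  then obtain p :: "int poly" where p: "cubic a' b' c' d' \<Theta> = poly (map_poly of_int p) (cubic a b c d \<Theta>)"
    unfolding gen int_adjoin_eq_poly by blast
  obtain a'' b'' c'' d'' where coords: "a'' \<in> gauss_rat" "b'' \<in> gauss_rat" "c'' \<in> gauss_rat" "d'' \<in> gauss_rat"
    "\<And>z. z ^ 4 = of_nat m \<Longrightarrow> poly (map_poly of_int p) (cubic a b c d z) = cubic a'' b'' c'' d'' z"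
    using poly_cubic[OF gr] by metis
  have "cubic a' b' c' d' \<Theta> = cubic a'' b'' c'' d'' \<Theta>" using p coords(5)[OF Theta_4] by simp
  then have "a' = a'' \<and> b' = b'' \<and> c' = c'' \<and> d' = d''" by (rule gauss_cubic_eq[OF gr' coords(1-4)])
  then have eval: "cubic a' b' c' d' z = poly (map_poly of_int p) (cubic a b c d z)" if "z \<in> roots" for z
    using coords(5)[OF roots_power_4[OF that]] by simp
  have "\<exists>q\<in>ZK. \<delta>' z = \<delta> z * q" if z: "z \<in> roots" for z
  proof -
    \<comment> \<open>With this root the twisted conjugate at \<open>z\<close> is the complex
      conjugate of the value at \<open>w\<close>, and conjugation commutes with integer
      polynomials.\<close>
    define w where "w = cnj (- of_int e * \<i> * z)"
    have w: "w \<in> roots" using z e by (auto simp: w_def roots_def)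
    have cw: "- of_int e * \<i> * z = cnj w" by (simp add: w_def)
    have "\<delta> z = cubic a b c d z - cnj (cubic a b c d w)"
      unfolding \<delta>_def cw by (simp add: cnj_cubic)
    moreover have "\<delta>' z = cubic a' b' c' d' z - cnj (cubic a' b' c' d' w)"
      unfolding \<delta>'_def cw by (simp add: cnj_cubic)
    then have "\<delta>' z = poly (map_poly of_int p) (cubic a b c d z) - poly (map_poly of_int p) (cnj (cubic a b c d w))"
      by (simp only: eval[OF z] eval[OF w] poly_of_int_cnj)
    ultimately show ?thesis
      using poly_diff_factor[OF ZK_add ZK_mult of_int_in_ZK ZK[OF z] ZK_cnj[OF ZK[OF w]], of p] by simp
  qed
  then obtain q where q: "\<And>z. z \<in> roots \<Longrightarrow> q z \<in> ZK \<and> \<delta>' z = \<delta> z * q z" by metis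
  define Q where "Q = q \<Theta> * q (- \<Theta>) * (q (\<i> * \<Theta>) * q (- (\<i> * \<Theta>)))"
  have r: "\<Theta> \<in> roots" "- \<Theta> \<in> roots" "\<i> * \<Theta> \<in> roots" "- (\<i> * \<Theta>) \<in> roots" by (auto simp: roots_def)
  have "Q \<in> ZK" unfolding Q_def using q r by (intro ZK_mult) blast+
  moreover have "twist_norm m e a' b' c' d' = twist_norm m e a b c d * Q"
    unfolding twist_norm_eq_prod[OF e] Q_def
    using q[OF r(1)] q[OF r(2)] q[OF r(3)] q[OF r(4)] by (simp add: \<delta>_def \<delta>'_def)
  ultimately show ?thesis by blast
qed

lemma twist_norm_in_ZK:
  assumes "integral_coords a b c d" "e = 1 \<or> e = - 1"
  shows "twist_norm m e a b c d \<in> ZK"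
proof -
  have ZK: "cubic a b c d z \<in> ZK" if "z \<in> roots" for z
    using assms(1) that by (auto simp: integral_coords_def)
  have "cubic (cnj a) (cnj b) (cnj c) (cnj d) z \<in> ZK" if "z \<in> roots" for z
  proof -
    have "cnj z \<in> roots" using that by (auto simp: roots_def)
    then have "cnj (cubic a b c d (cnj z)) \<in> ZK" by (intro ZK_cnj ZK)
    then show ?thesis by (simp add: cnj_cubic)
  qed
  moreover have "- of_int e * \<i> * z \<in> roots" if "z \<in> roots" for z
    using that assms(2) by (auto simp: roots_def)
  ultimately have conj: "cubic (cnj a) (cnj b) (cnj c) (cnj d) (- of_int e * \<i> * z) \<in> ZK" if "z \<in> roots" for z
    using that by blast
  show ?thesis
    unfolding twist_norm_eq_prod[OF assms(2)]
    by (intro ZK_mult ZK_diff ZK conj) (auto simp: roots_def)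
qed

lemma twist_norm_int_dvd:
  assumes gen: "ZK = int_adjoin (cubic a b c d \<Theta>)" and ic: "integral_coords a b c d"
    and e: "e = 1 \<or> e = - 1" and N: "twist_norm m e a b c d = of_int N"
    and ic': "integral_coords a' b' c' d'" and M: "twist_norm m e a' b' c' d' = of_int M"
  shows "N dvd M"
proof -
  obtain q where q: "q \<in> ZK" "(of_int M :: complex) = of_int N * q"
    using twist_norm_dvd[OF gen ic ic' e] N M by auto
  show ?thesis
  proof (cases "N = 0")
    case True
    with q show ?thesis by simp
  next
    case False
    then have "q = of_int M / of_int N" using q(2) by simp
    then have "q \<in> \<int>" using q(1) by (intro ZK_rat) auto
    then obtain k where "q = of_int k" by (auto elim: Ints_cases)
    then have "(of_int M :: complex) = of_int (N * k)" using q(2) by simp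
    then show ?thesis by (simp only: of_int_eq_iff) simp
  qed
qed

section \<open>Testing a generator against known integers\<close>

lemma twist_norm_generator:
  assumes gen: "ZK = int_adjoin (cubic a b c d \<Theta>)" and ic: "integral_coords a b c d"
    and coords: "2 * a = of_int x0 + \<i> * of_int y0" "2 * b = of_int x1 + \<i> * of_int y1"
      "2 * c = of_int x2 + \<i> * of_int y2" "2 * d = of_int x3 + \<i> * of_int y3"
    and e: "e = 1 \<or> e = - 1"
  obtains N where "twist_norm m e a b c d = of_int N" "N \<noteq> 0" "N dvd 16" "N dvd 4 * int m"
    "4 * N = 4 * (y0\<^sup>2 - int m * (e * x2)\<^sup>2 + int m * (x1 + e * y1) * (x3 - e * y3))\<^sup>2
      + int m * (4 * y0 * (e * x2) - (x1 + e * y1)\<^sup>2 + int m * (x3 - e * y3)\<^sup>2)\<^sup>2"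
proof -
  define F where "F = 4 * (y0\<^sup>2 - int m * (e * x2)\<^sup>2 + int m * (x1 + e * y1) * (x3 - e * y3))\<^sup>2
      + int m * (4 * y0 * (e * x2) - (x1 + e * y1)\<^sup>2 + int m * (x3 - e * y3)\<^sup>2)\<^sup>2"
  have F: "4 * twist_norm m e a b c d = of_int F"
    unfolding F_def by (rule twist_norm_formula[OF e coords])
  then have "twist_norm m e a b c d = of_int F / 4" by (simp add: eq_divide_eq mult.commute)
  then have "twist_norm m e a b c d \<in> \<rat>" by (simp only:) simp
  with twist_norm_in_ZK[OF ic e] have "twist_norm m e a b c d \<in> \<int>" by (rule ZK_rat)
  then obtain N where N: "twist_norm m e a b c d = of_int N" by (auto elim: Ints_cases)
  have "of_int (4 * N) = complex_of_int F" using F N by simp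
  then have "4 * N = F" by (simp only: of_int_eq_iff)
  \<comment> \<open>For \<open>\<i>\<close> the difference is \<open>2 * \<i>\<close>, with fourth
    power 16.\<close>
  moreover have "twist_norm m e \<i> 0 0 0 = of_int 16"
    using e by (auto simp: twist_norm_def norm_fst_def norm_snd_def power_mult_distrib)
  then have "N dvd 16"
    using twist_norm_int_dvd[OF gen ic e N integral_coords_gauss_int] by blast
  \<comment> \<open>For \<theta> the difference is \<open>(1 + e * \<i>) * \<theta>\<close>, whose
    norm is \<open>(1 + e * \<i>) ^ 4 * (- m) = 4 * m\<close>.\<close>
  moreover have "twist_norm m e 0 1 0 0 = of_int (4 * int m)"
    using e by (auto simp: twist_norm_def norm_fst_def norm_snd_def power2_eq_square algebra_simps)
  then have "N dvd 4 * int m"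
    using twist_norm_int_dvd[OF gen ic e N integral_coords_gauss_int] by blast
  moreover have "N \<noteq> 0" using \<open>N dvd 16\<close> by auto
  ultimately show thesis using that N unfolding F_def by blast
qed

text \<open>For odd \<open>n\<close> both values are twice an odd number, so a common divisor with
  16 divides 2.\<close>

lemma twist_norm_even_element:
  assumes "m = 2 * n"
  shows "twist_norm m 1 0 ((1 - \<i>) / 2) 0 (- \<i> / 2) = of_int (2 * int n ^ 3)"
    "twist_norm m (- 1) 0 ((1 - \<i>) / 2) 0 (- \<i> / 2) = of_int (2 * (int n * (int n + 2)\<^sup>2))"
  by (simp_all add: twist_norm_def norm_fst_def norm_snd_def assms power2_eq_square power3_eq_cube field_simps)

lemma not_monogene: "\<not> monogene quartic_field"
proof
  assume "monogene quartic_field"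
  then obtain \<alpha> where \<alpha>: "\<alpha> \<in> ZK" "ZK = int_adjoin \<alpha>" unfolding monogene_def by blast
  then have "\<alpha> \<in> quartic_field" by (simp add: ring_of_integers_def)
  then obtain a b c d where gr: "a \<in> gauss_rat" "b \<in> gauss_rat" "c \<in> gauss_rat" "d \<in> gauss_rat"
    and abcd: "\<alpha> = cubic a b c d \<Theta>" by (elim quartic_fieldE)
  have gen: "ZK = int_adjoin (cubic a b c d \<Theta>)" using \<alpha>(2) unfolding abcd .
  have ic: "integral_coords a b c d" using gr \<alpha>(1) unfolding abcd by (rule integral_coordsI)
  obtain x0 y0 x1 y1 x2 y2 x3 y3 :: int where coords: "2 * a = of_int x0 + \<i> * of_int y0"
      "2 * b = of_int x1 + \<i> * of_int y1" "2 * c = of_int x2 + \<i> * of_int y2" "2 * d = of_int x3 + \<i> * of_int y3"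
    using integral_coords_half[OF ic] unfolding gauss_int_iff by metis
  obtain N where N: "twist_norm m 1 a b c d = of_int N" "N \<noteq> 0" "N dvd 16" "N dvd 4 * int m"
    "4 * N = 4 * (y0\<^sup>2 - int m * x2\<^sup>2 + int m * (x1 + y1) * (x3 - y3))\<^sup>2
      + int m * (4 * y0 * x2 - (x1 + y1)\<^sup>2 + int m * (x3 - y3)\<^sup>2)\<^sup>2"
    by (rule twist_norm_generator[OF gen ic coords, of 1]) auto
  obtain N' where N': "twist_norm m (- 1) a b c d = of_int N'" "N' \<noteq> 0" "N' dvd 16" "N' dvd 4 * int m"
    "4 * N' = 4 * (y0\<^sup>2 - int m * (- x2)\<^sup>2 + int m * (x1 - y1) * (x3 + y3))\<^sup>2
      + int m * (4 * y0 * (- x2) - (x1 - y1)\<^sup>2 + int m * (x3 + y3)\<^sup>2)\<^sup>2"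
    by (rule twist_norm_generator[OF gen ic coords, of "- 1"]) auto
  consider "m mod 4 = 2" | "m mod 4 = 3" using m_mod_4 by (auto simp: cong_def)
  then show False
  proof cases
    case 1
    define n where "n = m div 2"
    have n: "m = 2 * n" "odd n" using 1 unfolding n_def by presburger+
    note el = even_integral_element[OF n]
    have "N dvd 2 * int n ^ 3"
      using twist_norm_int_dvd[OF gen ic _ N(1) el twist_norm_even_element(1)[OF n(1)]] by simp
    then have N2: "N dvd 2" using N(3) n(2) dvd_2_if_dvd_16_and_2_times_odd[of "int n ^ 3"] by simp
    have "N' dvd 2 * (int n * (int n + 2)\<^sup>2)"
      using twist_norm_int_dvd[OF gen ic _ N'(1) el twist_norm_even_element(2)[OF n(1)]] by simp
    then have N2': "N' dvd 2"
      using N'(3) n(2) dvd_2_if_dvd_16_and_2_times_odd[of "int n * (int n + 2)\<^sup>2"] by simp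
    show False
      using even_no_solution[OF _ _ N2 N(2) N2' N'(2) even_integral_coords[OF n ic coords] N(5) N'(5)]
        n m_gt_1 by simp
  next
    case 2
    then have m: "int m mod 4 = 3" by presburger
    show False
      using odd_no_solution[OF m _ dvd_4_if_dvd_16_and_4_times[OF m N(3,4)] N(2)
          dvd_4_if_dvd_16_and_4_times[OF m N'(3,4)] N'(2) odd_integral_coords[OF 2 ic coords] N(5) N'(5)]
        m_gt_1 by simp
  qed
qed

end

theorem theorem1:
  fixes m :: nat
  assumes "m > 0" and "squarefree m"
    and "[m = 2] (mod 4) \<or> [m = 3] (mod 4)"
  shows "\<not> monogene (rat_adjoin {\<i>, complex_of_real (root 4 (real m))})"
proof
  assume mono: "monogene (rat_adjoin {\<i>, complex_of_real (root 4 (real m))})"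
  interpret quartic m "root 4 (real m)"
    by unfold_locales (use assms in simp_all)
  have mono: "monogene quartic_field" using mono by (simp only: rat_adjoin_eq)
  then obtain \<alpha> where \<alpha>: "ring_of_integers quartic_field = int_adjoin \<alpha>"
    unfolding monogene_def by blast
  interpret quartic_integers m "root 4 (real m)"
  proof
    fix x y assume "x \<in> ring_of_integers quartic_field" "y \<in> ring_of_integers quartic_field"
    then show "x + y \<in> ring_of_integers quartic_field" "x * y \<in> ring_of_integers quartic_field"
      using generate_ring.eng_add[of x complex_field _ y] generate_ring.eng_mult[of x complex_field _ y]
      unfolding \<alpha> int_adjoin_def by (auto simp: ring_of_type_algebra_def)
  qed
  show False using not_monogene mono by contradiction
qed

end
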